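(* Let $d\geq 1$. Let $\mathbf{F}\in\mathscr{M}(\mathbb{R}^d;\mathbb{R}^d)$ be a measure with finite first moment and let $\mathbf{H}\in\mathscr{M}(\mathbb{R}^d;\mathcal{S}^d_+)$ be a matrix-valued measure such that $$ G(u) := -\int_{\mathbb{R}^d} u(x)\cdot\mathbf{F}(dx) - \int_{\mathbb{R}^d} \langle e(u(x)),\mathbf{H}(dx)\rangle \geq 0 $$ for all $u\in\mathrm{MON}(\mathbb{R}^d)$. Then there exists $\mathbf{M}\in\mathscr{M}(\mathbb{R}^d;\mathcal{S}^d_+)$ such that $$ G(u) = \int_{\mathbb{R}^d}\langle e(u(x)),\mathbf{M}(dx)\rangle \quad\text{for all } u\in\mathscr{D}(\mathbb{R}^d;\mathbb{R}^d), $$ where $G(u)$ is given by the formula $G(u) = -\int_{\mathbb{R}^d} u(x)\cdot\mathbf{F}(dx) - \int_{\mathbb{R}^d} \langle e(u(x)),\mathbf{H}(dx)\rangle$, and $$ \int_{\mathbb{R}^d}\mathrm{tr}(\mathbf{M}(dx)) \leq -\int_{\mathbb{R}^d} x\cdot\mathbf{F}(dx) - \int_{\mathbb{R}^d}\mathrm{tr}(\mathbf{H}(dx)). $$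
   Context: Notation. $x\cdot y$ is the Euclidean inner product and $|x|$ the Euclidean norm. $\mathbb{R}^{d\times d}$ is the space of real $d\times d$ matrices, with inner product $\langle A,B\rangle := \mathrm{tr}(AB^{\mathrm T})=\sum_{i,j=1}^d a_{ij}b_{ij}$. $\mathcal{S}^d$ is the space of symmetric real $d\times d$ matrices, and $\mathcal{S}^d_+\subset\mathcal{S}^d$ is the subset of positive semidefinite ones. For a square matrix $A$, $A^{\mathrm{sym}}:=(A+A^{\mathrm T})/2$. Function spaces. $\mathscr{C}_*(\mathbb{R}^d;\mathbb{R}^{d\times d})$ is the space of continuous functions $w\colon\mathbb{R}^d\to\mathbb{R}^{d\times d}$ for which $\lim_{|x|\to\infty}w(x)$ exists in $\mathbb{R}^{d\times d}$. For $u\in\mathscr{C}^1(\mathbb{R}^d;\mathbb{R}^d)$, the deformation tensor is $e(u(x)):=Du(x)^{\mathrm{sym}}$, where $Du$ is the Jacobian matrix. Set $$\mathscr{C}^1_*(\mathbb{R}^d;\mathbb{R}^d):=\{u\in\mathscr{C}^1(\mathbb{R}^d;\mathbb{R}^d)\colon Du\in\mathscr{C}_*(\mathbb{R}^d;\mathbb{R}^{d\times d})\},$$ $$\mathrm{MON}(\mathbb{R}^d):=\{u\in\mathscr{C}^1_*(\mathbb{R}^d;\mathbb{R}^d)\colon u\text{ is monotone}\},$$ where $u$ is monotone if $(u(x_1)-u(x_2))\cdot(x_1-x_2)\geq 0$ for all $x_1,x_2\in\mathbb{R}^d$. $\mathscr{D}(\mathbb{R}^d;\mathbb{R}^d)$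 is the space of smooth compactly supported maps $\mathbb{R}^d\to\mathbb{R}^d$. Measures. $\mathscr{M}(\mathbb{R}^d;\mathbb{R}^k)$ is the space of finite $\mathbb{R}^k$-valued Borel measures on $\mathbb{R}^d$, and $\mathscr{M}(\mathbb{R}^d;\mathcal{S}^d)$ is the space of finite $\mathcal{S}^d$-valued Borel measures. A measure $\mathbf{M}=(\mu_{i,j})\in\mathscr{M}(\mathbb{R}^d;\mathcal{S}^d)$ belongs to $\mathscr{M}(\mathbb{R}^d;\mathcal{S}^d_+)$ if and only if $\sum_{i,j=1}^d\mu_{i,j}v_iv_j$ is a positive (i.e. nonnegative) measure for every $v\in\mathbb{R}^d$. If $\mathbf{F}$ has components $f_1,\dots,f_d$, then $\int u(x)\cdot\mathbf{F}(dx):=\sum_{i=1}^d\int u_i(x)\,f_i(dx)$, and $\mathbf{F}$ has finite first moment if $\sum_{i=1}^d\int_{\mathbb{R}^d}|x|\,|f_i|(dx)<\infty$, where $|f_i|$ is the total variation measure. Similarly, $\int\langle v(x),\mathbf{M}(dx)\rangle:=\sum_{i,j=1}^d\int v_{i,j}(x)\,\mu_{i,j}(dx)$, and $\mathrm{tr}(\mathbf{M}(dx)):=\sum_{i=1}^d\mu_{i,i}(dx)$. Under these assumptions $G(u)$ is well defined and finite for every $u\in\mathscr{C}^1_*(\mathbb{R}^d;\mathbb{R}^d)$. *)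

theory Defs
  imports "HOL-Analysis.Analysis"
begin

section \<open>Finite signed and vector-valued Borel measures\<close>

text \<open>A finite vector-valued Borel measure is a countably additive set function on the Borel sets.
  Its values on sets that are not Borel are irrelevant and left unconstrained.\<close>

definition vector_measures :: "('a::topological_space set \<Rightarrow> 'b::real_normed_vector) set" where
  "vector_measures = {\<mu>. \<mu> {} = 0 \<and>
     (\<forall>A :: nat \<Rightarrow> 'a set. range A \<subseteq> sets borel \<longrightarrow> disjoint_family A \<longrightarrow>
        (\<lambda>n. \<mu> (A n)) sums \<mu> (\<Union>n. A n))}"

text \<open>The upper variation of the Jordan decomposition: the value at a Borel set \<open>A\<close> is
  the supremum of \<open>\<mu> B\<close> over the Borel subsets \<open>B\<close> of \<open>A\<close>. That \<open>measure_of\<close>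
  really yields this value (rather than the null measure) is \<open>emeasure_pos_variation\<close> below.
  Note that \<open>ennreal\<close> sends negative reals to 0, which does not change the
  supremum since \<open>B = {}\<close> is admitted.\<close>

definition pos_variation :: "('a::topological_space set \<Rightarrow> real) \<Rightarrow> 'a measure" where
  "pos_variation \<mu> = measure_of UNIV (sets borel)
     (\<lambda>A. SUP B \<in> {B \<in> sets borel. B \<subseteq> A}. ennreal (\<mu> B))"

definition neg_variation :: "('a::topological_space set \<Rightarrow> real) \<Rightarrow> 'a measure" where
  "neg_variation \<mu> = pos_variation (\<lambda>A. - \<mu> A)"

definition total_variation :: "('a::topological_space set \<Rightarrow> real) \<Rightarrow> 'a measure" where
  "total_variation \<mu> = measure_of UNIV (sets borel)
     (\<lambda>A. emeasure (pos_variation \<mu>) A + emeasure (neg_variation \<mu>) A)"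

definition signed_integral :: "('a::topological_space set \<Rightarrow> real) \<Rightarrow> ('a \<Rightarrow> real) \<Rightarrow> real" where
  "signed_integral \<mu> f = (\<integral>x. f x \<partial>pos_variation \<mu>) - (\<integral>x. f x \<partial>neg_variation \<mu>)"

lemma emeasure_pos_variation:
  fixes \<mu> :: "'a::topological_space set \<Rightarrow> real"
  assumes \<mu>: "\<mu> \<in> vector_measures" and A: "A \<in> sets borel"
  shows "emeasure (pos_variation \<mu>) A = (SUP B \<in> {B \<in> sets borel. B \<subseteq> A}. ennreal (\<mu> B))"
proof -
  define \<phi> where "\<phi> A = (SUP B \<in> {B \<in> sets borel. B \<subseteq> A}. ennreal (\<mu> B))" for A
  have empty: "\<mu> {} = 0" using \<mu> by (simp add: vector_measures_def)
  have sums: "(\<lambda>n. \<mu> (X n)) sums \<mu> (\<Union>n. X n)"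
    if "range X \<subseteq> sets borel" "disjoint_family X" for X :: "nat \<Rightarrow> 'a set"
    using \<mu> that by (simp add: vector_measures_def)
  have add: "\<mu> (B \<union> C) = \<mu> B + \<mu> C"
    if "B \<in> sets borel" "C \<in> sets borel" "B \<inter> C = {}" for B C
  proof -
    have "(\<lambda>n. \<mu> (binaryset B C n)) sums \<mu> (\<Union>n. binaryset B C n)"
      using that by (intro sums)
        (auto simp: range_binaryset_eq disjoint_family_on_def binaryset_def)
    moreover have "(\<lambda>n. \<mu> (binaryset B C n)) sums (\<mu> B + \<mu> C)"
      by (rule binaryset_sums) (rule empty)
    ultimately show ?thesis by (metis UN_binaryset_eq sums_unique2)
  qed
  have le: "ennreal (\<mu> B) \<le> \<phi> A" if "B \<in> sets borel" "B \<subseteq> A" for A B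
    unfolding \<phi>_def using that by (intro SUP_upper) auto
  have sup2: "\<phi> X + \<phi> Y \<le> \<phi> (X \<union> Y)" if disj: "X \<inter> Y = {}" for X Y
  proof -
    have main: "ennreal (\<mu> B) + ennreal (\<mu> C) \<le> \<phi> (X \<union> Y)"
      if B: "B \<in> sets borel" "B \<subseteq> X" and C: "C \<in> sets borel" "C \<subseteq> Y" for B C
    proof -
      have BC: "B \<inter> C = {}" using disj B C by auto
      consider "\<mu> B \<le> 0" | "\<mu> C \<le> 0" | "\<mu> B \<ge> 0" "\<mu> C \<ge> 0" by linarith
      then show ?thesis
      proof cases
        case 1 then show ?thesis using le[of C "X \<union> Y"] C by (auto simp: ennreal_neg)
      next
        case 2 then show ?thesis using le[of B "X \<union> Y"] B by (auto simp: ennreal_neg)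
      next
        case 3
        then have "ennreal (\<mu> B) + ennreal (\<mu> C) = ennreal (\<mu> (B \<union> C))"
          using add[OF B(1) C(1) BC] by simp
        also have "\<dots> \<le> \<phi> (X \<union> Y)" using B C by (intro le) auto
        finally show ?thesis .
      qed
    qed
    have ne: "{B \<in> sets borel. B \<subseteq> Z} \<noteq> {}" for Z :: "'a set" by auto
    have "\<phi> X + \<phi> Y = (SUP B \<in> {B \<in> sets borel. B \<subseteq> X}. ennreal (\<mu> B) + \<phi> Y)"
      unfolding \<phi>_def[of X] by (rule ennreal_SUP_add_left[symmetric, OF ne])
    also have "\<dots> = (SUP B \<in> {B \<in> sets borel. B \<subseteq> X}. SUP C \<in> {C \<in> sets borel. C \<subseteq> Y}.
        ennreal (\<mu> B) + ennreal (\<mu> C))"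
      unfolding \<phi>_def[of Y] by (simp add: ennreal_SUP_add_right[OF ne])
    also have "\<dots> \<le> \<phi> (X \<union> Y)" using main by (auto intro!: SUP_least)
    finally show ?thesis .
  qed
  have \<phi>_mono: "\<phi> X \<le> \<phi> Y" if "X \<subseteq> Y" for X Y
    unfolding \<phi>_def using that by (intro SUP_subset_mono) auto
  have "countably_additive (sets borel) \<phi>"
  proof (rule countably_additiveI)
    fix X :: "nat \<Rightarrow> 'a set"
    assume X: "range X \<subseteq> sets borel" "disjoint_family X"
    show "(\<Sum>i. \<phi> (X i)) = \<phi> (\<Union>i. X i)"
    proof (rule antisym)
      have part: "(\<Sum>i<n. \<phi> (X i)) \<le> \<phi> (\<Union>i<n. X i)" for n
      proof (induction n)
        case (Suc n)
        have "(\<Union>i<n. X i) \<inter> X n = {}"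
        proof -
          have "X i \<inter> X n = {}" if "i < n" for i
            using X(2) that by (simp add: disjoint_family_on_def)
          then show ?thesis by blast
        qed
        then have *: "\<phi> (\<Union>i<n. X i) + \<phi> (X n) \<le> \<phi> ((\<Union>i<n. X i) \<union> X n)" by (rule sup2)
        have "(\<Union>i<Suc n. X i) = (\<Union>i<n. X i) \<union> X n" by (auto simp: less_Suc_eq)
        moreover have "(\<Sum>i<Suc n. \<phi> (X i)) \<le> \<phi> (\<Union>i<n. X i) + \<phi> (X n)"
          using Suc by (simp add: add_right_mono)
        ultimately show ?case using * by (simp only: order_trans)
      qed simp
      have "(\<Sum>i<n. \<phi> (X i)) \<le> \<phi> (\<Union>i. X i)" for n
        by (rule order_trans[OF part]) (rule \<phi>_mono, auto)
      then show "(\<Sum>i. \<phi> (X i)) \<le> \<phi> (\<Union>i. X i)"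
        by (intro suminf_le_const) auto
    next
      have "ennreal (\<mu> B) \<le> (\<Sum>i. \<phi> (X i))" if B: "B \<in> sets borel" "B \<subseteq> (\<Union>i. X i)" for B
      proof -
        have "(\<lambda>n. \<mu> (B \<inter> X n)) sums \<mu> (\<Union>n. B \<inter> X n)"
          using X B by (intro sums) (auto simp: disjoint_family_on_def)
        moreover have "(\<Union>n. B \<inter> X n) = B" using B by auto
        ultimately have "(\<lambda>n. \<Sum>i<n. \<mu> (B \<inter> X i)) \<longlonglongrightarrow> \<mu> B" by (simp add: sums_def)
        then have lim: "(\<lambda>n. ennreal (\<Sum>i<n. \<mu> (B \<inter> X i))) \<longlonglongrightarrow> ennreal (\<mu> B)"
          by (rule tendsto_ennrealI)
        have "ennreal (\<Sum>i<n. \<mu> (B \<inter> X i)) \<le> (\<Sum>i. \<phi> (X i))" for n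
        proof -
          have "ennreal (\<Sum>i<n. \<mu> (B \<inter> X i)) \<le> ennreal (\<Sum>i<n. max 0 (\<mu> (B \<inter> X i)))"
            by (intro ennreal_leI sum_mono) auto
          also have "\<dots> = (\<Sum>i<n. ennreal (max 0 (\<mu> (B \<inter> X i))))" by (simp add: sum_ennreal)
          also have "\<dots> \<le> (\<Sum>i<n. \<phi> (X i))"
          proof (rule sum_mono)
            fix i
            have "B \<inter> X i \<in> sets borel" using X(1) B by auto
            then have "ennreal (\<mu> (B \<inter> X i)) \<le> \<phi> (X i)" by (rule le) auto
            then show "ennreal (max 0 (\<mu> (B \<inter> X i))) \<le> \<phi> (X i)" by (simp add: max_def)
          qed
          also have "\<dots> \<le> (\<Sum>i. \<phi> (X i))" by (rule sum_le_suminf) auto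
          finally show ?thesis .
        qed
        then show ?thesis using lim by (intro LIMSEQ_le_const2) auto
      qed
      then show "\<phi> (\<Union>i. X i) \<le> (\<Sum>i. \<phi> (X i))"
        unfolding \<phi>_def[of "\<Union>i. X i"] by (auto intro!: SUP_least)
    qed
  qed
  moreover have "positive (sets borel) \<phi>"
  proof -
    have "{B \<in> sets borel. B \<subseteq> {}} = {{} :: 'a set}" by auto
    then show ?thesis by (simp add: positive_def \<phi>_def empty)
  qed
  moreover have "sigma_algebra UNIV (sets (borel :: 'a measure))"
    using sets.sigma_algebra_axioms[of "borel :: 'a measure"] by simp
  ultimately have "emeasure (measure_of UNIV (sets borel) \<phi>) A = \<phi> A"
    using A by (intro emeasure_measure_of_sigma)
  then show ?thesis unfolding pos_variation_def \<phi>_def .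
qed

lemma emeasure_total_variation:
  fixes \<mu> :: "'a::topological_space set \<Rightarrow> real"
  assumes A: "A \<in> sets borel"
  shows "emeasure (total_variation \<mu>) A =
    emeasure (pos_variation \<mu>) A + emeasure (neg_variation \<mu>) A"
proof -
  have alg: "sigma_algebra UNIV (sets (borel :: 'a measure))"
    using sets.sigma_algebra_axioms[of "borel :: 'a measure"] by simp
  have sets: "sets (pos_variation \<nu>) = sets borel" for \<nu> :: "'a set \<Rightarrow> real"
    unfolding pos_variation_def using sigma_algebra.sets_measure_of_eq[OF alg] by simp
  have "countably_additive (sets borel)
      (\<lambda>A. emeasure (pos_variation \<mu>) A + emeasure (neg_variation \<mu>) A)"
    by (rule countably_additiveI)
      (simp add: suminf_add[symmetric] suminf_emeasure sets neg_variation_def)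
  then show ?thesis
    unfolding total_variation_def using A
    by (intro emeasure_measure_of_sigma[OF alg]) (auto simp: positive_def)
qed

definition finite_first_moment ::
    "((real^'d) set \<Rightarrow> real^'d) \<Rightarrow> bool" where
  "finite_first_moment F \<longleftrightarrow>
     (\<Sum>i\<in>UNIV. \<integral>\<^sup>+x. ennreal (norm x) \<partial>total_variation (\<lambda>A. F A $ i)) < \<infinity>"

definition sym_measures :: "((real^'d) set \<Rightarrow> real^'d^'d) set" where
  "sym_measures = {M \<in> vector_measures. \<forall>A\<in>sets borel. transpose (M A) = M A}"

definition psd_measures :: "((real^'d) set \<Rightarrow> real^'d^'d) set" where
  "psd_measures = {M \<in> sym_measures.
     \<forall>v :: real^'d. \<forall>A\<in>sets borel. (\<Sum>i\<in>UNIV. \<Sum>j\<in>UNIV. M A $ i $ j * v $ i * v $ j) \<ge> 0}"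

definition vec_integral ::
    "((real^'d) set \<Rightarrow> real^'d) \<Rightarrow> (real^'d \<Rightarrow> real^'d) \<Rightarrow> real" where
  "vec_integral F u = (\<Sum>i\<in>UNIV. signed_integral (\<lambda>A. F A $ i) (\<lambda>x. u x $ i))"

definition mat_integral ::
    "((real^'d) set \<Rightarrow> real^'d^'d) \<Rightarrow> (real^'d \<Rightarrow> real^'d^'d) \<Rightarrow> real" where
  "mat_integral M w =
     (\<Sum>i\<in>UNIV. \<Sum>j\<in>UNIV. signed_integral (\<lambda>A. M A $ i $ j) (\<lambda>x. w x $ i $ j))"

definition trace_integral :: "((real^'d) set \<Rightarrow> real^'d^'d) \<Rightarrow> real" where
  "trace_integral M = signed_integral (\<lambda>A. trace (M A)) (\<lambda>x. 1)"

section \<open>Function spaces\<close>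

definition sym_part :: "real^'d^'d \<Rightarrow> real^'d^'d" where
  "sym_part A = (1/2) *\<^sub>R (A + transpose A)"

definition deformation :: "(real^'d \<Rightarrow> real^'d) \<Rightarrow> real^'d \<Rightarrow> real^'d^'d" where
  "deformation u x = sym_part (jacobian u (at x))"

definition C_star :: "(real^'d \<Rightarrow> real^'d^'d) set" where
  "C_star = {w. continuous_on UNIV w \<and> (\<exists>L. (w \<longlongrightarrow> L) at_infinity)}"

definition C1 :: "(real^'d \<Rightarrow> real^'d) set" where
  "C1 = {u. (\<forall>x. u differentiable at x) \<and> continuous_on UNIV (\<lambda>x. jacobian u (at x))}"

definition C1_star :: "(real^'d \<Rightarrow> real^'d) set" where
  "C1_star = {u \<in> C1. (\<lambda>x. jacobian u (at x)) \<in> C_star}"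

definition monotone_map :: "('a::real_inner \<Rightarrow> 'a) \<Rightarrow> bool" where
  "monotone_map u \<longleftrightarrow> (\<forall>x y. (u x - u y) \<bullet> (x - y) \<ge> 0)"

definition MON :: "(real^'d \<Rightarrow> real^'d) set" where
  "MON = {u \<in> C1_star. monotone_map u}"

text \<open>\<open>k_smooth k u\<close>: \<open>u\<close> is of class \<open>C\<^sup>k\<close>. In finite dimension it suffices to ask
  this of the directional derivatives, which avoids iterated spaces of linear maps.\<close>

primrec k_smooth ::
    "nat \<Rightarrow> ('a::euclidean_space \<Rightarrow> 'b::real_normed_vector) \<Rightarrow> bool" where
  "k_smooth 0 u \<longleftrightarrow> continuous_on UNIV u"
| "k_smooth (Suc k) u \<longleftrightarrow> (\<forall>x. u differentiable at x) \<and>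
     (\<forall>v. k_smooth k (\<lambda>x. frechet_derivative u (at x) v))"

definition test_functions :: "(real^'d \<Rightarrow> real^'d) set" where
  "test_functions = {u. (\<forall>k. k_smooth k u) \<and> compact (closure {x. u x \<noteq> 0})}"

section \<open>The functional\<close>

definition G ::
    "((real^'d) set \<Rightarrow> real^'d) \<Rightarrow> ((real^'d) set \<Rightarrow> real^'d^'d) \<Rightarrow> (real^'d \<Rightarrow> real^'d) \<Rightarrow> real" where
  "G F H u = - vec_integral F u - mat_integral H (deformation u)"

end

theory Submission
  imports Defs
begin

text \<open>The hypothesis says that \<open>G\<close> is a positive functional of the deformation tensor. Viewing a tensor field
  \<open>w\<close> as the function \<open>(x, \<xi>) \<mapsto> \<xi> \<bullet> (w x *v \<xi>)\<close> on space times the unit sphere turns matrix positivity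
  into pointwise positivity, and the identity map into the constant 1, an order unit. A Hahn-Banach
  argument then extends \<open>G\<close> to a positive linear functional on all bounded continuous functions of
  \<open>(x, \<xi>)\<close>. By the Riesz theorem it is integration against a finite measure \<open>P\<close>, at least
  on compactly supported functions. The second moments \<open>\<xi> $ i * \<xi> $ j\<close> of \<open>P\<close> in the fibre variable
  form the matrix measure \<open>M\<close>. Mass that escapes to infinity is lost in \<open>P\<close>, which is
  why the trace satisfies only an inequality.\<close>

section \<open>Sublinear functionals\<close>

text \<open>A map whose deformation tensor has nonnegative quadratic forms is monotone, and the
  admissible maps include the identity. So if the quadratic forms of the tensor of \<open>w\<close>
  are at least \<open>c\<close> on unit vectors, subtracting \<open>c\<close> times the identity
  leaves a monotone map, and \<open>c * G F H (\<lambda>x. x) \<le> G F H w\<close>. With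
  \<open>c = 0\<close>, applied to a difference of two maps and its negative, this shows that
  \<open>G\<close> depends on the tensor alone; with general \<open>c\<close> it keeps the infimum
  in the Hahn-Banach argument finite. The tensor of the identity does not decay, so the extension
  must live on bounded continuous functions over a noncompact space, where a positive functional
  need not come from a measure. It does on compactly supported functions, and test functions have
  tensors of compact support in \<open>x\<close>. In the fibre variable, functions are defined on
  the whole space although only unit vectors matter: domination is tested on the sphere alone, so
  the functional ignores values off the sphere, and a quadratic form may be truncated there to
  become bounded and compactly supported.\<close>

definition sublinear :: "('v::real_vector \<Rightarrow> real) \<Rightarrow> bool" where
  "sublinear p \<longleftrightarrow> (\<forall>x y. p (x + y) \<le> p x + p y) \<and> (\<forall>c\<ge>0. \<forall>x. p (c *\<^sub>R x) = c * p x)"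

lemma sublinear_add: "sublinear p \<Longrightarrow> p (x + y) \<le> p x + p y"
  and sublinear_scaleR: "sublinear p \<Longrightarrow> 0 \<le> c \<Longrightarrow> p (c *\<^sub>R x) = c * p x"
  by (auto simp: sublinear_def)

lemma sublinear_zero: "sublinear p \<Longrightarrow> p 0 = 0"
  using sublinear_scaleR[of p 0 0] by simp

lemma sublinear_minus: "sublinear p \<Longrightarrow> - p (- x) \<le> p x"
  using sublinear_add[of p x "- x"] sublinear_zero[of p] by simp

text \<open>This serves three infima: over multiples of a direction, over a chain of functionals,
  and over majorizing maps. Only infima matter, so \<open>add\<close> and \<open>scale\<close> ask
  for an element below the expected value; \<open>scale\<close> covers positive factors, and the
  factor 0 is settled by \<open>zero\<close>.\<close>

lemma sublinear_Inf:
  assumes bdd: "\<And>x. bdd_below (A x)" and ne: "\<And>x. A x \<noteq> {}"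
    and zero: "0 \<in> A 0" "\<And>a. a \<in> A 0 \<Longrightarrow> 0 \<le> a"
    and add: "\<And>x y a b. a \<in> A x \<Longrightarrow> b \<in> A y \<Longrightarrow> \<exists>c\<in>A (x + y). c \<le> a + b"
    and scale: "\<And>c x a. 0 < c \<Longrightarrow> a \<in> A x \<Longrightarrow> \<exists>b\<in>A (c *\<^sub>R x). b \<le> c * a"
  shows "sublinear (\<lambda>x. Inf (A x))"
proof -
  define q where "q x = Inf (A x)" for x
  have le: "q x \<le> a" if "a \<in> A x" for a x
    unfolding q_def using that bdd by (rule cInf_lower)
  have greatest: "c \<le> q x" if "\<And>a. a \<in> A x \<Longrightarrow> c \<le> a" for c x
    unfolding q_def using ne that by (rule cInf_greatest)
  have "q (x + y) \<le> q x + q y" for x y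
  proof -
    have "q (x + y) - b \<le> q x" if b: "b \<in> A y" for b
    proof (rule greatest)
      fix a assume "a \<in> A x"
      then obtain c where "c \<in> A (x + y)" "c \<le> a + b" using add b by blast
      then show "q (x + y) - b \<le> a" using le[of c "x + y"] by simp
    qed
    then have "q (x + y) - q x \<le> q y" by (intro greatest) (smt (verit))
    then show ?thesis by simp
  qed
  moreover have "q (c *\<^sub>R x) = c * q x" if "c \<ge> 0" for c x
  proof (cases "c = 0")
    case True
    have "q 0 = 0" using le[OF zero(1)] greatest[of 0 0] zero(2) by simp
    then show ?thesis using True by simp
  next
    case False
    have *: "q (d *\<^sub>R z) \<le> d * q z" if d: "d > 0" for d z
    proof -
      have "q (d *\<^sub>R z) / d \<le> q z"
      proof (rule greatest)
        fix a assume "a \<in> A z"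
        then obtain b where "b \<in> A (d *\<^sub>R z)" "b \<le> d * a" using scale d by blast
        then show "q (d *\<^sub>R z) / d \<le> a" using le[of b "d *\<^sub>R z"] d by (simp add: field_simps)
      qed
      then show ?thesis using d by (simp add: field_simps)
    qed
    \<comment> \<open>The inequality for \<open>c\<close> and for its inverse together give
      equality.\<close>
    show ?thesis using *[of c x] *[of "inverse c" "c *\<^sub>R x"] False that by (simp add: field_simps)
  qed
  ultimately have "sublinear q" by (simp add: sublinear_def)
  then show ?thesis by (simp add: q_def[abs_def])
qed

text \<open>Subtracting as much as possible of the direction \<open>y\<close> yields a smaller sublinear functional,
  so a minimal sublinear functional is additive.\<close>

lemma sublinear_direction:
  assumes p: "sublinear p"
  obtains q where "sublinear q" "\<And>x. q x \<le> p x" "\<And>x. q x \<le> p (x + y) - p y"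
proof
  define A where "A x = {p (x + t *\<^sub>R y) - t * p y | t. 0 \<le> t}" for x
  \<comment> \<open>This bound does not depend on \<open>t\<close>, so the infimum over
    \<open>t\<close> is finite.\<close>
  have lower: "- p (- x) \<le> p (x + t *\<^sub>R y) - t * p y" if "t \<ge> 0" for x t
    using sublinear_add[OF p, of "x + t *\<^sub>R y" "- x"] sublinear_scaleR[OF p that, of y] by simp
  then have bdd: "bdd_below (A x)" for x
    unfolding A_def by (intro bdd_belowI[of _ "- p (- x)"]) auto
  have mem: "p (x + t *\<^sub>R y) - t * p y \<in> A x" if "t \<ge> 0" for x t using that by (auto simp: A_def)
  show "sublinear (\<lambda>x. Inf (A x))"
  proof (rule sublinear_Inf)
    show "bdd_below (A x)" "A x \<noteq> {}" for x using bdd mem[of 0 x] by auto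
    show "0 \<in> A 0" using mem[of 0 0] sublinear_zero[OF p] by simp
    show "0 \<le> a" if "a \<in> A 0" for a using that sublinear_scaleR[OF p] by (auto simp: A_def)
  next
    fix x z a b assume "a \<in> A x" "b \<in> A z"
    then obtain s t where st: "s \<ge> 0" "a = p (x + s *\<^sub>R y) - s * p y" "t \<ge> 0" "b = p (z + t *\<^sub>R y) - t * p y"
      by (auto simp: A_def)
    have "x + z + (s + t) *\<^sub>R y = (x + s *\<^sub>R y) + (z + t *\<^sub>R y)" by (simp add: algebra_simps)
    then have "p (x + z + (s + t) *\<^sub>R y) - (s + t) * p y \<le> a + b"
      using sublinear_add[OF p, of "x + s *\<^sub>R y" "z + t *\<^sub>R y"] st by (simp add: algebra_simps)
    then show "\<exists>c\<in>A (x + z). c \<le> a + b" using st mem[of "s + t" "x + z"] by auto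
  next
    fix c x a assume c: "(0::real) < c" and "a \<in> A x"
    then obtain t where t: "t \<ge> 0" "a = p (x + t *\<^sub>R y) - t * p y" by (auto simp: A_def)
    have "c *\<^sub>R x + (c * t) *\<^sub>R y = c *\<^sub>R (x + t *\<^sub>R y)" by (simp add: algebra_simps)
    then have "p (c *\<^sub>R x + (c * t) *\<^sub>R y) - (c * t) * p y \<le> c * a"
      using sublinear_scaleR[OF p, of c "x + t *\<^sub>R y"] c unfolding t(2) by (simp add: right_diff_distrib mult.assoc)
    then show "\<exists>b\<in>A (c *\<^sub>R x). b \<le> c * a" using c t mem[of "c * t" "c *\<^sub>R x"] by auto
  qed
  show "Inf (A x) \<le> p x" "Inf (A x) \<le> p (x + y) - p y" for x
    using cInf_lower[OF mem[of 0 x] bdd] cInf_lower[OF mem[of 1 x] bdd] by simp_all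
qed

text \<open>The Hahn-Banach theorem for the zero subspace; extension theorems follow by choosing
  \<open>p\<close> as an infimum over the subspace.\<close>

theorem sublinear_dominates_linear:
  fixes p :: "'v::real_vector \<Rightarrow> real"
  assumes p: "sublinear p"
  obtains f where "linear f" "\<And>x. f x \<le> p x"
proof -
  define A where "A = {q. sublinear q \<and> q \<le> p}"
  have "\<exists>m\<in>A. \<forall>q\<in>A. q \<le> m \<longrightarrow> q = m"
  \<comment> \<open>The order is reversed: a maximal element for it is a minimal sublinear
    functional below \<open>p\<close>.\<close>
  proof (rule predicate_Zorn[where P="\<lambda>q r. r \<le> q"])
    show "partial_order_on A (relation_of (\<lambda>q r. r \<le> q) A)"
      by (auto simp: partial_order_on_def preorder_on_def refl_on_def trans_def antisym_def relation_of_def)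
  next
    fix C assume C: "C \<in> Chains (relation_of (\<lambda>q r. r \<le> q) A)"
    then have CA: "C \<subseteq> A" and chain: "\<And>q r. q \<in> C \<Longrightarrow> r \<in> C \<Longrightarrow> q \<le> r \<or> r \<le> q"
      by (auto simp: Chains_def relation_of_def)
    show "\<exists>u\<in>A. \<forall>q\<in>C. u \<le> q"
    proof (cases "C = {}")
      case True then show ?thesis using p by (auto simp: A_def)
    next
      case False
      have sub: "sublinear q" "\<And>x. q x \<le> p x" if "q \<in> C" for q
        using CA that by (auto simp: A_def le_fun_def)
      have "- p (- x) \<le> q x" if "q \<in> C" for q x
        using sublinear_minus[OF sub(1)[OF that], of x] sub(2)[OF that, of "- x"] by simp
      then have bdd: "bdd_below ((\<lambda>q. q x) ` C)" for x by (intro bdd_belowI2)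
      define u where "u = (\<lambda>x. INF q\<in>C. q x)"
      have le: "u x \<le> q x" if "q \<in> C" for q x
        unfolding u_def using that by (intro cINF_lower bdd)
      have "sublinear u"
        unfolding u_def
      proof (rule sublinear_Inf[OF bdd])
        show "(\<lambda>q. q x) ` C \<noteq> {}" for x using False by simp
        show "0 \<in> (\<lambda>q. q 0) ` C" "\<And>a. a \<in> (\<lambda>q. q 0) ` C \<Longrightarrow> 0 \<le> a"
          using False sublinear_zero[OF sub(1)] by force+
      next
        fix x y a b assume "a \<in> (\<lambda>q. q x) ` C" "b \<in> (\<lambda>q. q y) ` C"
        then obtain q r where qr: "q \<in> C" "a = q x" "r \<in> C" "b = r y" by auto
        \<comment> \<open>The two infima may be approached along different members of the chain; the
          smaller member handles both arguments at once.\<close>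
        then obtain s where s: "s \<in> C" "s \<le> q" "s \<le> r" using chain by blast
        have "s (x + y) \<le> s x + s y" by (rule sublinear_add[OF sub(1)[OF s(1)]])
        also have "\<dots> \<le> a + b" using s qr by (intro add_mono) (auto simp: le_fun_def)
        finally show "\<exists>c\<in>(\<lambda>q. q (x + y)) ` C. c \<le> a + b" using s by auto
      next
        fix c x a assume "(0::real) < c" "a \<in> (\<lambda>q. q x) ` C"
        then show "\<exists>b\<in>(\<lambda>q. q (c *\<^sub>R x)) ` C. b \<le> c * a"
          using sublinear_scaleR[OF sub(1), of _ c x] by force
      qed
      moreover have "u \<le> p"
        using False le sub(2) order_trans by (fastforce simp: le_fun_def)
      ultimately have "u \<in> A" by (simp add: A_def)
      then show ?thesis using le by (auto simp: le_fun_def)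
    qed
  qed
  then obtain m where m: "sublinear m" "m \<le> p" and min: "\<And>q. sublinear q \<Longrightarrow> q \<le> m \<Longrightarrow> q = m"
    by (auto simp: A_def intro: order_trans)
  have add: "m (x + y) = m x + m y" for x y
  proof -
    obtain q where q: "sublinear q" "\<And>x. q x \<le> m x" "\<And>x. q x \<le> m (x + y) - m y"
      using sublinear_direction[OF m(1)] by blast
    then have "q = m" by (intro min) (auto simp: le_fun_def)
    then have "m x \<le> m (x + y) - m y" using q(3) by simp
    then show ?thesis using sublinear_add[OF m(1), of x y] by simp
  qed
  have minus: "m (- x) = - m x" for x using add[of x "- x"] sublinear_zero[OF m(1)] by simp
  have "linear m"
  proof (rule linearI)
    fix c x show "m (c *\<^sub>R x) = c *\<^sub>R m x"
    proof (cases "c \<ge> 0")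
      case True then show ?thesis using sublinear_scaleR[OF m(1)] by simp
    next
      case False
      then show ?thesis using sublinear_scaleR[OF m(1), of "- c" x] minus[of "c *\<^sub>R x"] by simp
    qed
  qed (rule add)
  then show ?thesis using m(2) by (intro that) (auto simp: le_fun_def)
qed

section \<open>The Riesz representation theorem\<close>

lemma apply_Bcontfun_real:
  fixes f :: "'a::topological_space \<Rightarrow> real"
  assumes "continuous_on UNIV f" "\<And>x. \<bar>f x\<bar> \<le> c"
  shows "apply_bcontfun (Bcontfun f) = f"
  using bcontfun_normI[of f c] assms by (simp add: Bcontfun_inverse)

lemma abs_bcontfun_le: "\<bar>apply_bcontfun f x\<bar> \<le> norm f" for f :: "'a::topological_space \<Rightarrow>\<^sub>C real"
  using norm_bounded[of f x] by simp

lemma apply_Bcontfun_mult: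
  fixes f g :: "'a::topological_space \<Rightarrow>\<^sub>C real"
  shows "apply_bcontfun (Bcontfun (\<lambda>x. f x * g x)) = (\<lambda>x. f x * g x)"
proof (rule apply_Bcontfun_real)
  show "\<bar>f x * g x\<bar> \<le> norm f * norm g" for x
    using mult_mono'[OF abs_bcontfun_le[of f x] abs_bcontfun_le[of g x]] by (simp add: abs_mult)
qed (auto intro!: continuous_intros)

lemma apply_bcontfun_sum: "apply_bcontfun (\<Sum>i\<in>I. f i) x = (\<Sum>i\<in>I. apply_bcontfun (f i) x)"
  for f :: "'i \<Rightarrow> 'a::topological_space \<Rightarrow>\<^sub>C 'b::real_normed_vector"
  by (induction I rule: infinite_finite_induct) simp_all

text \<open>On a noncompact space such a functional may live at infinity, like a generalized limit,
  and then no measure represents it. The representation below is therefore restricted to functions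
  that vanish off a compact set.\<close>

locale positive_functional =
  fixes L :: "('a::metric_space \<Rightarrow>\<^sub>C real) \<Rightarrow> real"
  assumes linear: "linear L"
    and nonneg: "(\<And>x. 0 \<le> apply_bcontfun f x) \<Longrightarrow> 0 \<le> L f"
begin

section \<open>The outer measure induced by a positive functional\<close>

lemma mono: "(\<And>x. apply_bcontfun f x \<le> apply_bcontfun g x) \<Longrightarrow> L f \<le> L g"
  using nonneg[of "g - f"] linear_diff[OF linear, of g f] by simp

text \<open>Sequences of functions replace covers by open sets, so that \<open>L\<close> applies to
  them directly; \<open>outer A\<close> is then Daniell's upper integral of the indicator of
  \<open>A\<close>. Summing in \<open>ennreal\<close> admits sequences whose sum diverges.\<close>

definition covers :: "'a set \<Rightarrow> (nat \<Rightarrow> 'a \<Rightarrow>\<^sub>C real) set" where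
  "covers A = {f :: nat \<Rightarrow> 'a \<Rightarrow>\<^sub>C real. (\<forall>n x. 0 \<le> f n x) \<and> (\<forall>x\<in>A. 1 \<le> (\<Sum>n. ennreal (f n x)))}"

definition outer :: "'a set \<Rightarrow> ennreal" where
  "outer A = (INF f\<in>covers A. \<Sum>n. ennreal (L (f n)))"

lemma outer_le: "f \<in> covers A \<Longrightarrow> outer A \<le> (\<Sum>n. ennreal (L (f n)))"
  unfolding outer_def by (rule INF_lower)

lemma outer_mono: "A \<subseteq> B \<Longrightarrow> outer A \<le> outer B"
  unfolding outer_def by (rule INF_superset_mono) (auto simp: covers_def)

text \<open>A doubly indexed cover is enumerated along \<open>prod_decode\<close>; sums of
  nonnegative terms do not depend on the order.\<close>

lemma outer_le_double:
  assumes nn: "\<And>m n x. 0 \<le> apply_bcontfun (g m n) x"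
    and cov: "\<And>x. x \<in> A \<Longrightarrow> 1 \<le> (\<Sum>m. \<Sum>n. ennreal (g m n x))"
  shows "outer A \<le> (\<Sum>m. \<Sum>n. ennreal (L (g m n)))"
proof -
  define f where "f k = (case prod_decode k of (m, n) \<Rightarrow> g m n)" for k
  have sum: "(\<Sum>k. ennreal (h (f k))) = (\<Sum>m. \<Sum>n. ennreal (h (g m n)))" for h
    using suminf_ennreal_2dimen[of _ "\<lambda>(m, n). ennreal (h (g m n))", OF refl]
    by (simp add: f_def case_prod_beta)
  have "1 \<le> (\<Sum>k. ennreal (f k x))" if "x \<in> A" for x
    using cov[OF that] sum[of "\<lambda>b. apply_bcontfun b x"] by simp
  moreover have "0 \<le> f k x" for k x using nn by (simp add: f_def split: prod.split)
  ultimately have "f \<in> covers A" by (simp add: covers_def)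
  then show ?thesis using outer_le[of f] sum[of L] by simp
qed

lemma outer_le_single:
  assumes "\<And>x. 0 \<le> apply_bcontfun g x" "\<And>x. x \<in> A \<Longrightarrow> 1 \<le> apply_bcontfun g x"
  shows "outer A \<le> ennreal (L g)"
proof -
  define f where "f n = (if n = 0 then g else 0)" for n :: nat
  have sum: "(\<Sum>n. ennreal (h (f n))) = ennreal (h g)" if "h 0 = 0" for h
    using suminf_finite[of "{0}" "\<lambda>n. ennreal (h (f n))"] that by (simp add: f_def)
  have "1 \<le> (\<Sum>n. ennreal (f n x))" if "x \<in> A" for x
    using assms(2)[OF that] sum[of "\<lambda>b. apply_bcontfun b x"] by (simp add: ennreal_ge_1)
  moreover have "0 \<le> f n x" for n x using assms(1) by (simp add: f_def)
  ultimately have "f \<in> covers A" by (simp add: covers_def)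
  then show ?thesis using outer_le[of f] sum[of L] linear_0[OF linear] by simp
qed

lemma outer_finite: "outer A < top"
  using outer_le_single[of "const_bcontfun 1" A] by (auto intro: le_less_trans)

lemma outer_empty: "outer {} = 0"
  using outer_le_single[of 0 "{}"] linear_0[OF linear] by simp

lemma outer_countably_subadditive: "outer (\<Union>i. A i) \<le> (\<Sum>i. outer (A i))" for A :: "nat \<Rightarrow> 'a set"
proof (rule ennreal_le_epsilon)
  fix e :: real assume e: "e > 0"
  \<comment> \<open>The errors \<open>e * (1/2) ^ Suc i\<close> add up to \<open>e\<close>. The
    strict inequality relies on \<open>outer (A i)\<close> being finite.\<close>
  have "\<exists>f\<in>covers (A i). (\<Sum>n. ennreal (L (f n))) < outer (A i) + ennreal (e * (1/2) ^ Suc i)" for i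
  proof -
    have "outer (A i) < outer (A i) + ennreal (e * (1/2) ^ Suc i)"
      using e outer_finite[of "A i"] by (simp add: ennreal_add_left_cancel_less)
    then show ?thesis unfolding outer_def[of "A i"] by (simp add: INF_less_iff)
  qed
  then obtain f where f: "\<And>i. f i \<in> covers (A i)"
      "\<And>i. (\<Sum>n. ennreal (L (f i n))) < outer (A i) + ennreal (e * (1/2) ^ Suc i)"
    by metis
  have "outer (\<Union>i. A i) \<le> (\<Sum>i. \<Sum>n. ennreal (L (f i n)))"
  proof (rule outer_le_double)
    show "0 \<le> f m n x" for m n x using f(1) by (auto simp: covers_def)
    fix x assume "x \<in> (\<Union>i. A i)"
    then obtain i where "x \<in> A i" by auto
    then have "1 \<le> (\<Sum>n. ennreal (f i n x))" using f(1) by (auto simp: covers_def)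
    also have "\<dots> = (\<Sum>i\<in>{i}. \<Sum>n. ennreal (f i n x))" by simp
    also have "\<dots> \<le> (\<Sum>i. \<Sum>n. ennreal (f i n x))" by (rule sum_le_suminf) auto
    finally show "1 \<le> (\<Sum>i. \<Sum>n. ennreal (f i n x))" .
  qed
  also have "\<dots> \<le> (\<Sum>i. outer (A i) + ennreal (e * (1/2) ^ Suc i))"
    using f(2) by (intro suminf_le) (auto simp: less_imp_le)
  also have "\<dots> = (\<Sum>i. outer (A i)) + (\<Sum>i. ennreal (e * (1/2) ^ Suc i))"
    by (rule suminf_add[symmetric]) auto
  also have "(\<lambda>i. e * (1/2) ^ Suc i) sums (e * 1)" by (intro sums_mult power_half_series)
  then have "(\<Sum>i. ennreal (e * (1/2) ^ Suc i)) = ennreal (e * 1)"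
    using e by (intro suminf_ennreal_eq) auto
  finally show "outer (\<Union>i. A i) \<le> (\<Sum>i. outer (A i)) + ennreal e" by simp
qed

lemma outer_measure_space_outer: "outer_measure_space (Pow UNIV) outer"
  by (auto simp: outer_measure_space_def positive_def increasing_def countably_subadditive_def
      outer_empty intro: outer_mono outer_countably_subadditive)

lemma outer_Un: "outer (A \<union> B) \<le> outer A + outer B"
proof -
  have "outer (\<Union>i. binaryset A B i) \<le> (\<Sum>i. outer (binaryset A B i))"
    by (rule outer_countably_subadditive)
  also have "(\<Sum>i. outer (binaryset A B i)) = outer A + outer B"
    by (rule suminf_binaryset_eq) (rule outer_empty)
  finally show ?thesis by (simp add: UN_binaryset_eq)
qed

text \<open>A cover \<open>f\<close> of \<open>E\<close> is split along continuous functions \<open>\<phi> k\<close> increasing to the indicator of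
  the open set \<open>U\<close>: the products of \<open>f n\<close> with the differences \<open>\<phi> (Suc k) - \<phi> k\<close> form
  a cover of \<open>E \<inter> U\<close>, and its products with \<open>1 - \<phi> k\<close> a cover of \<open>E - U\<close>.\<close>

lemma outer_open_split:
  assumes U: "open U" "U \<noteq> UNIV" and f: "f \<in> covers E"
  shows "outer (E \<inter> U) + outer (E - U) \<le> (\<Sum>n. ennreal (L (f n)))"
proof -
  \<comment> \<open>For \<open>U = UNIV\<close> the distance to the empty set would take its default
    value 0 and every \<open>\<phi> k\<close> would vanish; hence the assumption
    \<open>U \<noteq> UNIV\<close>.\<close>
  define \<phi> :: "nat \<Rightarrow> 'a \<Rightarrow>\<^sub>C real" where "\<phi> k = Bcontfun (\<lambda>x. min 1 (real k * infdist x (- U)))" for k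
  have \<phi>: "\<phi> k x = min 1 (real k * infdist x (- U))" for k x
  proof -
    have "continuous_on UNIV (\<lambda>x. min 1 (real k * infdist x (- U)))" by (intro continuous_intros)
    moreover have "\<bar>min 1 (real k * infdist x (- U))\<bar> \<le> 1" for x
      using infdist_nonneg[of x "- U"] by (simp add: abs_le_iff min_def)
    ultimately show ?thesis unfolding \<phi>_def by (rule apply_Bcontfun_real[THEN fun_cong])
  qed
  have \<phi>_Suc: "\<phi> k x \<le> \<phi> (Suc k) x" for k x
    using infdist_nonneg[of x "- U"] by (auto simp: \<phi> min_def algebra_simps)
  have \<phi>_le: "\<phi> k x \<le> 1" for k x by (simp add: \<phi>)
  define times where "times a b = Bcontfun (\<lambda>x. apply_bcontfun a x * apply_bcontfun b x)"
    for a b :: "'a \<Rightarrow>\<^sub>C real"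
  have times: "times a b x = a x * b x" for a b x
    by (simp add: times_def apply_Bcontfun_mult)
  have fnn: "0 \<le> f n x" and fcov: "x \<in> E \<Longrightarrow> 1 \<le> (\<Sum>n. ennreal (f n x))" for n x
    using f by (auto simp: covers_def)
  define g where "g k n = times (f n) (\<phi> (Suc k) - \<phi> k)" for k n
  have gnn: "0 \<le> g k n x" for k n x using fnn \<phi>_Suc by (simp add: g_def times)
  have in_U: "outer (E \<inter> U) \<le> (\<Sum>k. \<Sum>n. ennreal (L (g k n)))"
  proof (rule outer_le_double[OF gnn])
    fix x assume x: "x \<in> E \<inter> U"
    have "infdist x (- U) > 0"
      using x U by (intro infdist_pos_not_in_closed) auto
    then obtain K where "1 < real K * infdist x (- U)" by (metis ex_less_of_nat_mult)
    then have "1 = \<phi> K x - \<phi> 0 x" by (simp add: \<phi>)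
    also have "\<dots> = (\<Sum>k<K. \<phi> (Suc k) x - \<phi> k x)" by (rule sum_lessThan_telescope[symmetric])
    finally have "1 = ennreal (\<Sum>k<K. \<phi> (Suc k) x - \<phi> k x)" by simp
    also have "\<dots> = (\<Sum>k<K. ennreal (\<phi> (Suc k) x - \<phi> k x))"
      using \<phi>_Suc by (intro sum_ennreal[symmetric]) auto
    also have "\<dots> \<le> (\<Sum>k. ennreal (\<phi> (Suc k) x - \<phi> k x))" by (rule sum_le_suminf) auto
    also have "\<dots> \<le> (\<Sum>k. \<Sum>n. ennreal (g k n x))"
    proof (rule suminf_le)
      fix k
      have "ennreal (\<phi> (Suc k) x - \<phi> k x) * 1 \<le> ennreal (\<phi> (Suc k) x - \<phi> k x) * (\<Sum>n. ennreal (f n x))"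
        using fcov x by (intro mult_left_mono) auto
      also have "\<dots> = (\<Sum>n. ennreal (g k n x))"
        using \<phi>_Suc fnn by (simp add: g_def times ennreal_mult' mult.commute[of "apply_bcontfun _ _"])
      finally show "ennreal (\<phi> (Suc k) x - \<phi> k x) \<le> (\<Sum>n. ennreal (g k n x))" by simp
    qed auto
    finally show "1 \<le> (\<Sum>k. \<Sum>n. ennreal (g k n x))" .
  qed
  \<comment> \<open>\<open>L\<close> is only finitely additive. So the first \<open>K\<close> layers
    and the remainder \<open>1 - \<phi> K\<close> are recombined to exactly \<open>f n\<close>, and
    the supremum over \<open>K\<close> is taken afterwards.\<close>
  have partial: "(\<Sum>k<K. \<Sum>n. ennreal (L (g k n))) + outer (E - U) \<le> (\<Sum>n. ennreal (L (f n)))" for K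
  proof -
    define h where "h n = times (f n) (const_bcontfun 1 - \<phi> K)" for n
    have hnn: "0 \<le> h n x" for n x using fnn \<phi>_le by (simp add: h_def times)
    have "\<phi> K x = 0" if "x \<notin> U" for x using that by (simp add: \<phi>)
    then have "h \<in> covers (E - U)"
      using hnn fcov by (auto simp: covers_def) (simp add: h_def times)
    then have "outer (E - U) \<le> (\<Sum>n. ennreal (L (h n)))" by (rule outer_le)
    moreover have "(\<Sum>k<K. \<Sum>n. ennreal (L (g k n))) + (\<Sum>n. ennreal (L (h n))) = (\<Sum>n. ennreal (L (f n)))"
    proof -
      have split: "(\<Sum>k<K. L (g k n)) + L (h n) = L (f n)" for n
      proof -
        have "(\<Sum>k<K. L (g k n)) + L (h n) = L ((\<Sum>k<K. g k n) + h n)"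
          by (simp add: linear_add[OF linear] linear_sum[OF linear])
        also have "(\<Sum>k<K. g k n) + h n = f n"
        proof (rule bcontfun_eqI)
          fix x
          have "((\<Sum>k<K. g k n) + h n) x = f n x * (\<Sum>k<K. \<phi> (Suc k) x - \<phi> k x) + h n x"
            by (simp add: apply_bcontfun_sum g_def times sum_distrib_left)
          also have "\<dots> = f n x"
            by (subst sum_lessThan_telescope) (simp add: h_def times \<phi> algebra_simps)
          finally show "((\<Sum>k<K. g k n) + h n) x = f n x" .
        qed
        finally show ?thesis .
      qed
      have "(\<Sum>k<K. \<Sum>n. ennreal (L (g k n))) = (\<Sum>n. \<Sum>k<K. ennreal (L (g k n)))"
        by (rule suminf_sum[symmetric]) auto
      then have "(\<Sum>k<K. \<Sum>n. ennreal (L (g k n))) + (\<Sum>n. ennreal (L (h n))) =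
          (\<Sum>n. (\<Sum>k<K. ennreal (L (g k n))) + ennreal (L (h n)))"
        by (simp add: suminf_add)
      also have "\<dots> = (\<Sum>n. ennreal (L (f n)))"
        using nonneg[OF gnn] nonneg[OF hnn]
        by (simp add: sum_nonneg split flip: ennreal_plus)
      finally show ?thesis .
    qed
    ultimately show ?thesis by (metis add_left_mono)
  qed
  have "(\<Sum>k. \<Sum>n. ennreal (L (g k n))) + outer (E - U) =
      (SUP K. (\<Sum>k<K. \<Sum>n. ennreal (L (g k n))) + outer (E - U))"
    by (simp add: suminf_eq_SUP[of "\<lambda>k. \<Sum>n. ennreal (L (g k n))"] ennreal_SUP_add_left)
  also have "\<dots> \<le> (\<Sum>n. ennreal (L (f n)))" by (rule SUP_least) (rule partial)
  finally show ?thesis using in_U by (meson add_right_mono order_trans)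
qed

lemma open_outer_measurable:
  assumes "open U"
  shows "U \<in> lambda_system UNIV (Pow UNIV) outer"
proof -
  have "outer (U \<inter> E) + outer (E - U) = outer E" for E
  proof (rule antisym)
    show "outer (U \<inter> E) + outer (E - U) \<le> outer E"
    proof (cases "U = UNIV")
      case True then show ?thesis by (simp add: outer_empty)
    next
      case False
      then show ?thesis
        unfolding outer_def[of E] using outer_open_split[OF assms] by (intro INF_greatest) (auto simp: Int_commute)
    qed
    show "outer E \<le> outer (U \<inter> E) + outer (E - U)"
      using outer_Un[of "U \<inter> E" "E - U"] by (simp add: Int_commute Int_Diff_Un)
  qed
  then show ?thesis by (auto simp: lambda_system_def Diff_eq Int_commute)
qed

section \<open>Caratheodory's extension to the Borel sets\<close>

definition riesz_measure :: "'a measure" where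
  "riesz_measure = measure_of UNIV (sets borel) outer"

lemma sets_riesz_measure [simp, measurable_cong]: "sets riesz_measure = sets borel"
  and space_riesz_measure [simp]: "space riesz_measure = UNIV"
  unfolding riesz_measure_def
  using sigma_algebra.sets_measure_of_eq[OF sets.sigma_algebra_axioms[of "borel :: 'a measure"]]
  by (auto simp: space_measure_of_conv)

text \<open>By Caratheodory's theorem \<open>outer\<close> is a measure on a sigma-algebra that
  contains the open sets, hence all Borel sets. This keeps \<open>measure_of\<close> from returning
  its default, the null measure.\<close>

lemma emeasure_riesz_measure:
  assumes "A \<in> sets borel"
  shows "emeasure riesz_measure A = outer A"
proof -
  interpret P: sigma_algebra "UNIV :: 'a set" "Pow UNIV" by (rule sigma_algebra_Pow)
  have ms: "measure_space UNIV (lambda_system UNIV (Pow UNIV) outer) outer"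
    by (rule P.caratheodory_lemma) (rule outer_measure_space_outer)
  then have sa: "sigma_algebra UNIV (lambda_system UNIV (Pow UNIV) outer)"
    by (simp add: measure_space_def)
  have "sigma_sets UNIV (Collect open) \<subseteq> lambda_system UNIV (Pow UNIV) outer"
    by (rule sigma_algebra.sigma_sets_subset[OF sa]) (use open_outer_measurable in blast)
  then have sub: "sets borel \<subseteq> lambda_system UNIV (Pow UNIV) outer"
    by (simp add: borel_def)
  have "countably_additive (sets borel) outer" "positive (sets borel) outer"
    using ms sub by (auto simp: measure_space_def countably_additive_def positive_def)
  then show ?thesis
    unfolding riesz_measure_def
    using assms sets.sigma_algebra_axioms[of "borel :: 'a measure"]
    by (intro emeasure_measure_of_sigma) auto
qed

section \<open>Comparison of the functional with the integral\<close>

lemma finite_riesz_measure: "finite_measure riesz_measure"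
  using outer_finite by (intro finite_measureI) (simp add: emeasure_riesz_measure less_top)

text \<open>The single function \<open>(1 / t) *\<^sub>R g\<close> already covers
  \<open>A\<close>.\<close>

lemma measure_riesz_measure_le:
  assumes "A \<in> sets borel" "t > 0" "\<And>x. 0 \<le> apply_bcontfun g x" "\<And>x. x \<in> A \<Longrightarrow> t \<le> apply_bcontfun g x"
  shows "t * measure riesz_measure A \<le> L g"
proof -
  have "outer A \<le> ennreal (L ((1 / t) *\<^sub>R g))"
    using assms by (intro outer_le_single) (auto simp: field_simps)
  moreover have "0 \<le> L ((1 / t) *\<^sub>R g)" using assms by (intro nonneg) auto
  ultimately have "measure riesz_measure A \<le> L ((1 / t) *\<^sub>R g)"
    using assms(1) by (simp add: measure_def emeasure_riesz_measure enn2real_leI)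
  then show ?thesis using assms(2) by (simp add: linear_scale[OF linear] field_simps)
qed

text \<open>Dini's theorem: finitely many functions of a cover of the compact set \<open>K\<close> already add up to almost 1
  on \<open>K\<close>.\<close>

lemma le_measure_riesz_measure:
  assumes K: "compact K" and t: "t > 0"
    and g: "\<And>x. x \<in> K \<Longrightarrow> apply_bcontfun g x \<le> t" "\<And>x. x \<notin> K \<Longrightarrow> apply_bcontfun g x \<le> 0"
  shows "L g \<le> t * measure riesz_measure K"
proof -
  have "ennreal (L g / t) \<le> outer K"
    unfolding outer_def
  proof (rule INF_greatest)
    fix f assume f: "f \<in> covers K"
    then have fnn: "0 \<le> f n x" and fcov: "x \<in> K \<Longrightarrow> 1 \<le> (\<Sum>n. ennreal (f n x))" for n x
      by (auto simp: covers_def)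
    show "ennreal (L g / t) \<le> (\<Sum>n. ennreal (L (f n)))"
    proof (cases "(\<Sum>n. ennreal (L (f n)))")
      case (real s)
      \<comment> \<open>A factor \<open>z\<close> below 1 makes room for strict inequalities, so
        that the sets where a partial sum exceeds \<open>z\<close> are open and exhaust
        \<open>K\<close>; in the end \<open>z\<close> tends to 1.\<close>
      have "z * (L g / t) \<le> s" if z: "0 < z" "z < 1" for z
      proof -
        define U where "U N = {x. z < (\<Sum>n<N. f n x)}" for N
        have U: "open (U N)" for N
          unfolding U_def by (intro open_Collect_less continuous_intros) auto
        have "K \<subseteq> (\<Union>N. U N)"
        proof
          fix x assume "x \<in> K"
          have "ennreal z < 1" using z by (simp add: ennreal_less_one_iff)
          also have "1 \<le> (\<Sum>n. ennreal (f n x))" using \<open>x \<in> K\<close> by (rule fcov)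
          finally have "ennreal z < (\<Sum>n. ennreal (f n x))" .
          then obtain N where "ennreal z < (\<Sum>n<N. ennreal (f n x))" by (auto simp: suminf_eq_SUP less_SUP_iff)
          then have "x \<in> U N" using fnn z by (simp add: U_def sum_nonneg ennreal_less_iff)
          then show "x \<in> (\<Union>N. U N)" by auto
        qed
        then obtain I where I: "finite I" "K \<subseteq> (\<Union>N\<in>I. U N)"
          using compactE_image[OF K, of UNIV U] U by auto
        obtain N where N: "\<And>i. i \<in> I \<Longrightarrow> i \<le> N" using I(1) finite_nat_set_iff_bounded_le by auto
        have "z / t * g x \<le> (\<Sum>n<N. f n x)" for x
        proof (cases "x \<in> K")
          case True
          then obtain i where i: "i \<in> I" "z < (\<Sum>n<i. f n x)" using I by (auto simp: U_def)
          have "z / t * g x \<le> z" using g(1)[OF True] z t by (simp add: field_simps)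
          also have "\<dots> \<le> (\<Sum>n<i. f n x)" using i by simp
          also have "\<dots> \<le> (\<Sum>n<N. f n x)" using N[OF i(1)] fnn by (intro sum_mono2) auto
          finally show ?thesis .
        next
          case False
          then have "z / t * g x \<le> 0" using g(2)[of x] z t by (intro mult_nonneg_nonpos) auto
          also have "\<dots> \<le> (\<Sum>n<N. f n x)" using fnn by (intro sum_nonneg) auto
          finally show ?thesis .
        qed
        then have "L ((z / t) *\<^sub>R g) \<le> L (\<Sum>n<N. f n)" by (intro mono) (simp add: apply_bcontfun_sum)
        then have "z * (L g / t) \<le> (\<Sum>n<N. L (f n))"
          by (simp add: linear_scale[OF linear] linear_sum[OF linear])
        also have "\<dots> \<le> s"
        proof -
          have "ennreal (\<Sum>n<N. L (f n)) = (\<Sum>n<N. ennreal (L (f n)))"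
            using fnn by (simp add: sum_ennreal nonneg)
          also have "\<dots> \<le> (\<Sum>n. ennreal (L (f n)))" by (rule sum_le_suminf) auto
          finally show ?thesis using real by simp
        qed
        finally show ?thesis .
      qed
      then have "L g / t \<le> s" by (rule field_le_mult_one_interval)
      then show ?thesis using real by (simp add: ennreal_leI)
    qed auto
  qed
  also have "outer K = ennreal (measure riesz_measure K)"
    using finite_measure.emeasure_eq_measure[OF finite_riesz_measure, of K]
      emeasure_riesz_measure[of K] K by (simp add: borel_compact)
  finally show ?thesis using t by (simp add: field_simps)
qed

lemma integrable_riesz_measure [simp]: "integrable riesz_measure (apply_bcontfun f)" for f :: "'a \<Rightarrow>\<^sub>C real"
  by (rule finite_measure.integrable_const_bound[OF finite_riesz_measure, where B="norm f"])
    (auto simp: abs_bcontfun_le cong: measurable_cong_sets intro!: borel_measurable_continuous_onI)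

text \<open>Slice \<open>f\<close> horizontally into \<open>N\<close> layers. The functional and the integral agree on each layer up to its
  height times the difference of the measures of its base and its top, and these errors telescope.\<close>

lemma integral_riesz_measure_nonneg:
  assumes K: "compact K" and f: "\<And>x. x \<notin> K \<Longrightarrow> apply_bcontfun f x = 0" and nn: "\<And>x. 0 \<le> apply_bcontfun f x"
  shows "(\<integral>x. f x \<partial>riesz_measure) = L f"
proof -
  interpret finite_measure riesz_measure by (rule finite_riesz_measure)
  define D where "D g = L g - (\<integral>x. apply_bcontfun g x \<partial>riesz_measure)" for g
  have D_diff: "D (g - h) = D g - D h" for g h
    by (simp add: D_def linear_diff[OF linear])
  \<comment> \<open>The summand 1 keeps the layer height \<open>c / N\<close> positive even for
    \<open>f = 0\<close>.\<close>
  define c where "c = norm f + 1"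
  have c: "c > 0" "f x \<le> c" for x
    using abs_bcontfun_le[of f x] norm_ge_zero[of f] unfolding c_def by (auto simp del: norm_ge_zero)
  have bound: "\<bar>D f\<bar> \<le> c * measure riesz_measure UNIV / real N" if N: "N > 0" for N
  proof -
    define e where "e = c / real N"
    have e: "e > 0" "real N * e = c" using c N by (auto simp: e_def)
    define h where "h j = Bcontfun (\<lambda>x. min (f x) (real j * e))" for j
    have h: "h j x = min (f x) (real j * e)" for j x
    proof -
      have "continuous_on UNIV (\<lambda>x. min (f x) (real j * e))"
        by (intro continuous_intros continuous_on_apply_bcontfun)
      moreover have "\<bar>min (f x) (real j * e)\<bar> \<le> norm f" for x
        using abs_bcontfun_le[of f x] nn[of x] e by (simp add: abs_le_iff min_le_iff_disj min_def)
      ultimately show ?thesis unfolding h_def by (rule apply_Bcontfun_real[THEN fun_cong])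
    qed
    \<comment> \<open>Intersecting with \<open>K\<close> matters for \<open>j = 0\<close>, where the
      level set alone is the whole space.\<close>
    define A where "A j = K \<inter> {x. real j * e \<le> f x}" for j
    have A: "compact (A j)" for j
      unfolding A_def by (intro compact_Int_closed K closed_Collect_le continuous_intros) auto
    have A_mono: "A (Suc j) \<subseteq> A j" for j using e by (auto simp: A_def algebra_simps)
    have A_sets: "A j \<in> sets borel" for j using A by (rule borel_compact)
    have [simp]: "integrable riesz_measure (indicat_real (A j))" for j
      using A_sets by (simp add: less_top[symmetric])
    have layer_nn: "0 \<le> (h (Suc j) - h j) x" for j x using e by (auto simp: h min_def algebra_simps)
    have layer_le: "(h (Suc j) - h j) x \<le> e * indicator (A j) x" for j x
      using e f[of x] nn[of x] by (auto simp: h min_def algebra_simps A_def indicator_def)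
    have layer_ge: "e * indicator (A (Suc j)) x \<le> (h (Suc j) - h j) x" for j x
      using e layer_nn[of j x] by (auto simp: h min_def algebra_simps A_def indicator_def)
    have layer: "\<bar>D (h (Suc j) - h j)\<bar> \<le> e * (measure riesz_measure (A j) - measure riesz_measure (A (Suc j)))" for j
    proof -
      have "L (h (Suc j) - h j) \<le> e * measure riesz_measure (A j)"
        using layer_le[of j] by (intro le_measure_riesz_measure[OF A e(1)]) (metis indicator_simps mult_1_right mult_zero_right)+
      moreover have "e * measure riesz_measure (A (Suc j)) \<le> L (h (Suc j) - h j)"
        using layer_ge[of j] by (intro measure_riesz_measure_le[OF A_sets e(1) layer_nn]) (metis indicator_simps mult_1_right)
      moreover have "(\<integral>x. (h (Suc j) - h j) x \<partial>riesz_measure) \<le> (\<integral>x. e * indicator (A j) x \<partial>riesz_measure)"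
        using A_sets by (intro integral_mono layer_le) (auto simp del: minus_bcontfun.rep_eq)
      moreover have "(\<integral>x. e * indicator (A (Suc j)) x \<partial>riesz_measure) \<le> (\<integral>x. (h (Suc j) - h j) x \<partial>riesz_measure)"
        using A_sets by (intro integral_mono layer_ge) (auto simp del: minus_bcontfun.rep_eq)
      ultimately show ?thesis
        using A_sets unfolding D_def by (simp add: abs_le_iff algebra_simps)
    qed
    have "h 0 = 0" "h N = f"
      using nn c e by (auto intro!: bcontfun_eqI antisym simp: h min_def)
    moreover have "D 0 = 0" using D_diff[of 0 0] by simp
    ultimately have "D f = (\<Sum>j<N. D (h (Suc j)) - D (h j))"
      using sum_lessThan_telescope[of "\<lambda>j. D (h j)" N] by simp
    also have "\<bar>\<dots>\<bar> \<le> (\<Sum>j<N. \<bar>D (h (Suc j) - h j)\<bar>)" unfolding D_diff by (rule sum_abs)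
    also have "\<dots> \<le> (\<Sum>j<N. e * (measure riesz_measure (A j) - measure riesz_measure (A (Suc j))))"
      by (intro sum_mono layer)
    also have "\<dots> = e * (measure riesz_measure (A 0) - measure riesz_measure (A N))"
      using sum_lessThan_telescope'[of "\<lambda>j. measure riesz_measure (A j)" N]
      by (simp flip: sum_distrib_left)
    also have "\<dots> \<le> e * measure riesz_measure UNIV"
      using e finite_measure_mono[of "A 0" UNIV] measure_nonneg[of riesz_measure "A N"]
      by (intro mult_left_mono; simp del: measure_nonneg)
    finally show ?thesis by (simp add: e_def)
  qed
  have "(\<lambda>N. c * measure riesz_measure UNIV / real N) \<longlonglongrightarrow> 0" by (rule lim_const_over_n)
  then have "\<bar>D f\<bar> \<le> 0"
    by (rule LIMSEQ_le_const) (use bound in \<open>auto intro!: exI[of _ 1]\<close>)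
  then show ?thesis by (simp add: D_def)
qed

theorem integral_riesz_measure:
  assumes K: "compact K" and f: "\<And>x. x \<notin> K \<Longrightarrow> apply_bcontfun f x = 0"
  shows "(\<integral>x. f x \<partial>riesz_measure) = L f"
proof -
  define pos where "pos g = Bcontfun (\<lambda>x. max 0 (apply_bcontfun g x))" for g :: "'a \<Rightarrow>\<^sub>C real"
  have pos: "pos g x = max 0 (g x)" for g x
  proof -
    have "continuous_on UNIV (\<lambda>x. max 0 (g x))" by (intro continuous_intros continuous_on_apply_bcontfun)
    moreover have "\<bar>max 0 (g x)\<bar> \<le> norm g" for x
      using abs_bcontfun_le[of g x] by simp
    ultimately show ?thesis unfolding pos_def by (rule apply_Bcontfun_real[THEN fun_cong])
  qed
  have split: "f = pos f - pos (- f)" by (rule bcontfun_eqI) (simp add: pos max_def)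
  have "(\<integral>x. pos f x \<partial>riesz_measure) = L (pos f)" "(\<integral>x. pos (- f) x \<partial>riesz_measure) = L (pos (- f))"
    by (intro integral_riesz_measure_nonneg[OF K]; simp add: pos f)+
  then have "(\<integral>x. (pos f - pos (- f)) x \<partial>riesz_measure) = L (pos f - pos (- f))"
    by (simp add: linear_diff[OF linear])
  then show ?thesis using split by simp
qed

end

section \<open>Signed measures\<close>

lemma vector_measures_empty: "\<mu> \<in> vector_measures \<Longrightarrow> \<mu> {} = 0"
  by (simp add: vector_measures_def)

lemma vector_measures_sums:
  "\<mu> \<in> vector_measures \<Longrightarrow> range A \<subseteq> sets borel \<Longrightarrow> disjoint_family A \<Longrightarrow>
    (\<lambda>n. \<mu> (A n)) sums \<mu> (\<Union>n. A n)"
  by (simp add: vector_measures_def)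

lemma vector_measuresI:
  assumes "\<mu> {} = 0"
    and "\<And>A. range A \<subseteq> sets borel \<Longrightarrow> disjoint_family A \<Longrightarrow> (\<lambda>n. \<mu> (A n)) sums \<mu> (\<Union>n. A n)"
  shows "\<mu> \<in> vector_measures"
  using assms by (simp add: vector_measures_def)

lemma vector_measures_linear_image:
  assumes f: "bounded_linear f" and \<mu>: "\<mu> \<in> vector_measures"
  shows "(\<lambda>A. f (\<mu> A)) \<in> vector_measures"
  using vector_measures_empty[OF \<mu>] linear_0[OF bounded_linear.linear[OF f]]
  by (intro vector_measuresI bounded_linear.sums[OF f] vector_measures_sums[OF \<mu>]) auto

lemma vector_measures_vecI:
  assumes "\<And>i. (\<lambda>A. \<mu> A $ i) \<in> vector_measures"
  shows "\<mu> \<in> vector_measures"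
proof (rule vector_measuresI)
  show "\<mu> {} = 0" using vector_measures_empty[OF assms] by (simp add: vec_eq_iff)
next
  fix A :: "nat \<Rightarrow> 'b set" assume "range A \<subseteq> sets borel" "disjoint_family A"
  then have "(\<lambda>n. \<mu> (A n) $ i) sums (\<mu> (\<Union>n. A n) $ i)" for i by (rule vector_measures_sums[OF assms])
  then show "(\<lambda>n. \<mu> (A n)) sums \<mu> (\<Union>n. A n)"
    by (auto simp: sums_def intro!: vec_tendstoI)
qed

lemma vector_measures_cong:
  assumes eq: "\<And>A. A \<in> sets borel \<Longrightarrow> \<mu> A = \<nu> A" and \<nu>: "\<nu> \<in> vector_measures"
  shows "\<mu> \<in> vector_measures"
proof (rule vector_measuresI)
  show "\<mu> {} = 0" using eq[of "{}"] vector_measures_empty[OF \<nu>] by simp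
next
  fix A :: "nat \<Rightarrow> 'a set" assume A: "range A \<subseteq> sets borel" "disjoint_family A"
  then have "\<mu> (A n) = \<nu> (A n)" "\<mu> (\<Union>n. A n) = \<nu> (\<Union>n. A n)" for n by (auto intro!: eq)
  then show "(\<lambda>n. \<mu> (A n)) sums \<mu> (\<Union>n. A n)" using vector_measures_sums[OF \<nu> A] by simp
qed

lemma vector_measures_Un:
  assumes \<mu>: "\<mu> \<in> vector_measures" and "A \<in> sets borel" "B \<in> sets borel" "A \<inter> B = {}"
  shows "\<mu> (A \<union> B) = \<mu> A + \<mu> B"
proof -
  have "(\<lambda>n. \<mu> (binaryset A B n)) sums \<mu> (\<Union>n. binaryset A B n)"
  proof -
    have "range (binaryset A B) \<subseteq> sets borel" "disjoint_family (binaryset A B)"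
      using assms by (auto simp: range_binaryset_eq disjoint_family_on_def binaryset_def)
    then show ?thesis using \<mu> by (simp add: vector_measures_def)
  qed
  moreover have "(\<lambda>n. \<mu> (binaryset A B n)) sums (\<mu> A + \<mu> B)"
    using \<mu> by (intro binaryset_sums) (simp add: vector_measures_def)
  ultimately show ?thesis by (metis UN_binaryset_eq sums_unique2)
qed

lemma vector_measures_Diff:
  assumes "\<mu> \<in> vector_measures" "A \<in> sets borel" "B \<in> sets borel" "B \<subseteq> A"
  shows "\<mu> (A - B) = \<mu> A - \<mu> B"
  using vector_measures_Un[of \<mu> B "A - B"] assms by (simp add: Un_absorb1 eq_diff_eq add.commute)

lemma vector_measures_uminus: "\<mu> \<in> vector_measures \<Longrightarrow> (\<lambda>A. - \<mu> A) \<in> vector_measures"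
  by (intro vector_measures_linear_image[where f="\<lambda>x. - x"] bounded_linear_minus bounded_linear_ident)

lemma sets_pos_variation [simp, measurable_cong]: "sets (pos_variation \<mu>) = sets borel"
  and space_pos_variation [simp]: "space (pos_variation \<mu>) = UNIV"
  unfolding pos_variation_def
  using sigma_algebra.sets_measure_of_eq[OF sets.sigma_algebra_axioms[of "borel :: 'a::topological_space measure"]]
  by (auto simp: space_measure_of_conv)

lemma sets_neg_variation [simp, measurable_cong]: "sets (neg_variation \<mu>) = sets borel"
  and space_neg_variation [simp]: "space (neg_variation \<mu>) = UNIV"
  by (simp_all add: neg_variation_def)

lemma sets_total_variation [simp, measurable_cong]:
  "sets (total_variation \<mu>) = sets (borel :: 'a::topological_space measure)"
  unfolding total_variation_def
  using sigma_algebra.sets_measure_of_eq[OF sets.sigma_algebra_axioms[of "borel :: 'a measure"]] by simp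

lemma pos_variation_ge:
  assumes "\<mu> \<in> vector_measures" "A \<in> sets borel" "B \<in> sets borel" "B \<subseteq> A"
  shows "ennreal (\<mu> B) \<le> emeasure (pos_variation \<mu>) A"
  using assms by (subst emeasure_pos_variation) (auto intro!: SUP_upper)

text \<open>A set of infinite variation splits into two parts of measure larger than 1 in absolute value, one of which
  has infinite variation again; iterating contradicts countable additivity.\<close>

lemma finite_pos_variation:
  assumes \<mu>: "\<mu> \<in> vector_measures"
  shows "finite_measure (pos_variation \<mu>)"
proof (rule ccontr)
  let ?\<phi> = "emeasure (pos_variation \<mu>)"
  define bad where "bad A \<longleftrightarrow> A \<in> sets borel \<and> ?\<phi> A = \<infinity>" for A
  assume "\<not> finite_measure (pos_variation \<mu>)"
  then have bad0: "bad UNIV" by (auto simp: bad_def intro: finite_measureI)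
  have "\<exists>B. B \<in> sets borel \<and> B \<subseteq> A \<and> 1 < \<bar>\<mu> B\<bar> \<and> bad (A - B)" if A: "bad A" for A
  proof -
    \<comment> \<open>The threshold also forces \<open>\<bar>\<mu> (A - C)\<bar>\<close> above 1, so
      either of \<open>C\<close> and \<open>A - C\<close> can be the part split off.\<close>
    have "ennreal (1 + \<bar>\<mu> A\<bar>) < ?\<phi> A" using A by (simp add: bad_def)
    then obtain C where C: "C \<in> sets borel" "C \<subseteq> A" "ennreal (1 + \<bar>\<mu> A\<bar>) < ennreal (\<mu> C)"
      using A emeasure_pos_variation[OF \<mu>, of A] unfolding bad_def less_SUP_iff by (metis (no_types, lifting) less_SUP_iff mem_Collect_eq)
    have big: "1 + \<bar>\<mu> A\<bar> < \<mu> C" using C(3) by (subst (asm) ennreal_less_iff) auto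
    have diff: "\<mu> (A - C) = \<mu> A - \<mu> C" using A C by (intro vector_measures_Diff \<mu>) (auto simp: bad_def)
    have "?\<phi> A = ?\<phi> C + ?\<phi> (A - C)"
      using A C by (subst plus_emeasure) (auto simp: bad_def Un_absorb1)
    then have "bad C \<or> bad (A - C)" using A C by (auto simp: bad_def)
    then show ?thesis
    proof
      assume "bad (A - C)"
      then show ?thesis using C big by (intro exI[of _ C]) auto
    next
      assume "bad C"
      moreover have "A - (A - C) = C" using C by auto
      ultimately show ?thesis using C A big diff by (intro exI[of _ "A - C"]) (auto simp: bad_def)
    qed
  qed
  then obtain \<beta> where \<beta>: "\<And>A. bad A \<Longrightarrow> \<beta> A \<in> sets borel \<and> \<beta> A \<subseteq> A \<and> 1 < \<bar>\<mu> (\<beta> A)\<bar> \<and> bad (A - \<beta> A)"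
    by metis
  define X where "X n = ((\<lambda>A. A - \<beta> A) ^^ n) UNIV" for n
  have X_Suc: "X (Suc n) = X n - \<beta> (X n)" for n by (simp add: X_def)
  have bad: "bad (X n)" for n by (induction n) (use bad0 \<beta> in \<open>auto simp: X_Suc X_def[of 0]\<close>)
  have decr: "X n \<subseteq> X m" if "m \<le> n" for m n
    using that by (induction rule: dec_induct) (auto simp: X_Suc)
  have "\<beta> (X m) \<inter> \<beta> (X n) = {}" if "m < n" for m n
    using decr[of "Suc m" n] that \<beta>[OF bad[of n]] by (auto simp: X_Suc)
  then have "disjoint_family (\<lambda>n. \<beta> (X n))"
    unfolding disjoint_family_on_def by (metis Int_commute nat_neq_iff)
  moreover have "range (\<lambda>n. \<beta> (X n)) \<subseteq> sets borel" using \<beta>[OF bad] by auto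
  ultimately have "(\<lambda>n. \<mu> (\<beta> (X n))) sums \<mu> (\<Union>n. \<beta> (X n))"
    using \<mu> by (simp add: vector_measures_def)
  then have "(\<lambda>n. \<mu> (\<beta> (X n))) \<longlonglongrightarrow> 0" using sums_summable summable_LIMSEQ_zero by blast
  then have "\<forall>\<^sub>F n in sequentially. \<bar>\<mu> (\<beta> (X n))\<bar> < 1"
    using tendstoD[of "\<lambda>n. \<mu> (\<beta> (X n))" 0 sequentially 1] by simp
  moreover have "\<forall>\<^sub>F n in sequentially. 1 < \<bar>\<mu> (\<beta> (X n))\<bar>" using \<beta>[OF bad] by simp
  ultimately have "\<forall>\<^sub>F n in sequentially. False" by eventually_elim simp
  then show False by simp
qed

lemma finite_neg_variation: "\<mu> \<in> vector_measures \<Longrightarrow> finite_measure (neg_variation \<mu>)"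
  unfolding neg_variation_def by (intro finite_pos_variation vector_measures_uminus)

text \<open>For \<open>B \<subseteq> A\<close>, the value at \<open>B\<close> is the value at
  \<open>A\<close> minus that at \<open>A - B\<close>, and the latter is controlled by the negative
  variation. The supremum over \<open>B\<close> gives one inequality, the same argument for
  \<open>- \<mu>\<close> the other; no Hahn decomposition enters.\<close>

lemma jordan_decomposition:
  assumes \<mu>: "\<mu> \<in> vector_measures" and A: "A \<in> sets borel"
  shows "\<mu> A = measure (pos_variation \<mu>) A - measure (neg_variation \<mu>) A"
proof -
  have le: "measure (pos_variation \<nu>) A \<le> \<nu> A + measure (pos_variation (\<lambda>A. - \<nu> A)) A"
    if \<nu>: "\<nu> \<in> vector_measures" for \<nu> :: "'a set \<Rightarrow> real"
  proof -
    interpret N: finite_measure "pos_variation (\<lambda>A. - \<nu> A)"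
      using \<nu> by (intro finite_pos_variation vector_measures_uminus)
    have *: "\<nu> B \<le> \<nu> A + measure (pos_variation (\<lambda>A. - \<nu> A)) A" if B: "B \<in> sets borel" "B \<subseteq> A" for B
    proof -
      have "ennreal (- \<nu> (A - B)) \<le> emeasure (pos_variation (\<lambda>A. - \<nu> A)) A"
        using \<nu> A B by (intro pos_variation_ge vector_measures_uminus) auto
      then have "- \<nu> (A - B) \<le> measure (pos_variation (\<lambda>A. - \<nu> A)) A"
        by (simp add: N.emeasure_eq_measure ennreal_le_iff)
      then show ?thesis using vector_measures_Diff[OF \<nu> A B] by simp
    qed
    then have "emeasure (pos_variation \<nu>) A \<le> ennreal (\<nu> A + measure (pos_variation (\<lambda>A. - \<nu> A)) A)"
      unfolding emeasure_pos_variation[OF \<nu> A] by (intro SUP_least ennreal_leI) auto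
    moreover have "0 \<le> \<nu> A + measure (pos_variation (\<lambda>A. - \<nu> A)) A"
      using *[of "{}"] \<nu> by (simp add: vector_measures_def)
    ultimately show ?thesis by (simp add: measure_def enn2real_leI)
  qed
  show ?thesis
    using le[OF \<mu>] le[OF vector_measures_uminus[OF \<mu>]] by (simp add: neg_variation_def)
qed

section \<open>Integration against signed measures\<close>

lemma vector_measures_measure_diff:
  fixes P N :: "'a::topological_space measure"
  assumes "finite_measure P" "finite_measure N" "sets P = sets borel" "sets N = sets borel"
  shows "(\<lambda>A. measure P A - measure N A) \<in> vector_measures"
  using assms by (intro vector_measuresI sums_diff finite_measure.finite_measure_UNION) auto

text \<open>This is the passage from \<open>P - N = P' - N'\<close> to integrals, written additively
  because subtraction in \<open>ennreal\<close> is truncated.\<close>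

lemma nn_integral_add_cong:
  fixes f :: "'a::topological_space \<Rightarrow> ennreal"
  assumes sets: "sets P = sets borel" "sets N = sets borel" "sets P' = sets borel" "sets N' = sets borel"
    and eq: "\<And>A. A \<in> sets borel \<Longrightarrow> emeasure P A + emeasure N' A = emeasure P' A + emeasure N A"
    and f: "f \<in> borel_measurable borel"
  shows "(\<integral>\<^sup>+x. f x \<partial>P) + (\<integral>\<^sup>+x. f x \<partial>N') = (\<integral>\<^sup>+x. f x \<partial>P') + (\<integral>\<^sup>+x. f x \<partial>N)"
  using f
proof (induction rule: borel_measurable_induct)
  case (cong f g)
  then show ?case by (simp cong: nn_integral_cong)
next
  case (set A)
  then show ?case using eq sets by simp
next
  case (mult u c)
  then have "u \<in> borel_measurable P" "u \<in> borel_measurable N" "u \<in> borel_measurable P'" "u \<in> borel_measurable N'"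
    using sets by (auto cong: measurable_cong_sets)
  then show ?case using mult by (simp add: nn_integral_cmult flip: distrib_left)
next
  case (add u v)
  have m: "w \<in> borel_measurable P" "w \<in> borel_measurable N" "w \<in> borel_measurable P'" "w \<in> borel_measurable N'"
    if "w \<in> borel_measurable borel" for w :: "'a \<Rightarrow> ennreal"
    using that sets by (auto cong: measurable_cong_sets)
  have "(integral\<^sup>N P v + integral\<^sup>N P u) + (integral\<^sup>N N' v + integral\<^sup>N N' u) =
      (integral\<^sup>N P v + integral\<^sup>N N' v) + (integral\<^sup>N P u + integral\<^sup>N N' u)"
    by (simp only: ac_simps)
  also have "\<dots> = (integral\<^sup>N P' v + integral\<^sup>N N v) + (integral\<^sup>N P' u + integral\<^sup>N N u)"
    using add.IH by simp
  also have "\<dots> = (integral\<^sup>N P' v + integral\<^sup>N P' u) + (integral\<^sup>N N v + integral\<^sup>N N u)"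
    by (simp only: ac_simps)
  finally show ?case
    using m[OF add.hyps(1)] m[OF add.hyps(3)] by (simp add: nn_integral_add)
next
  case (seq U)
  have m: "U i \<in> borel_measurable P" "U i \<in> borel_measurable N" "U i \<in> borel_measurable P'" "U i \<in> borel_measurable N'" for i
    using seq sets by (auto cong: measurable_cong_sets)
  have lim: "(\<lambda>i. integral\<^sup>N Q (U i)) \<longlonglongrightarrow> (\<integral>\<^sup>+x. (SUP i. U i) x \<partial>Q)" if "\<And>i. U i \<in> borel_measurable Q" for Q
  proof -
    have "(\<integral>\<^sup>+x. (SUP i. U i) x \<partial>Q) = (SUP i. integral\<^sup>N Q (U i))"
      using nn_integral_monotone_convergence_SUP[OF seq(3) that] by (simp add: image_comp)
    moreover have "incseq (\<lambda>i. integral\<^sup>N Q (U i))"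
      using seq(3) by (auto simp: incseq_def le_fun_def intro!: nn_integral_mono)
    ultimately show ?thesis by (metis LIMSEQ_SUP)
  qed
  have "(\<lambda>i. integral\<^sup>N P (U i) + integral\<^sup>N N' (U i)) \<longlonglongrightarrow> (\<integral>\<^sup>+x. (SUP i. U i) x \<partial>P) + (\<integral>\<^sup>+x. (SUP i. U i) x \<partial>N')"
    by (intro tendsto_add lim m)
  moreover have "(\<lambda>i. integral\<^sup>N P' (U i) + integral\<^sup>N N (U i)) \<longlonglongrightarrow> (\<integral>\<^sup>+x. (SUP i. U i) x \<partial>P') + (\<integral>\<^sup>+x. (SUP i. U i) x \<partial>N)"
    by (intro tendsto_add lim m)
  ultimately show ?case using seq by (simp add: LIMSEQ_unique)
qed

lemma integrable_bounded:
  fixes f :: "'a::topological_space \<Rightarrow> real"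
  assumes "finite_measure Q" "sets Q = sets borel" "f \<in> borel_measurable borel" "\<And>x. \<bar>f x\<bar> \<le> c"
  shows "integrable Q f"
  using assms by (intro finite_measure.integrable_const_bound[of Q f c]) (auto cong: measurable_cong_sets)

text \<open>The integral does not depend on the choice of the two measures: adding crosswise turns
  the two decompositions of \<open>\<mu>\<close> into an equality of sums of positive measures, and
  \<open>f\<close> is split into its positive and negative part.\<close>

lemma signed_integral_eq_diff:
  fixes f :: "'a::topological_space \<Rightarrow> real"
  assumes \<mu>: "\<mu> \<in> vector_measures"
    and P: "finite_measure P" "sets P = sets borel" and N: "finite_measure N" "sets N = sets borel"
    and eq: "\<And>A. A \<in> sets borel \<Longrightarrow> \<mu> A = measure P A - measure N A"
    and f: "f \<in> borel_measurable borel" "\<And>x. \<bar>f x\<bar> \<le> c"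
  shows "signed_integral \<mu> f = (\<integral>x. f x \<partial>P) - (\<integral>x. f x \<partial>N)"
proof -
  note fin = finite_pos_variation[OF \<mu>] finite_neg_variation[OF \<mu>]
  have meq: "emeasure (pos_variation \<mu>) A + emeasure N A = emeasure P A + emeasure (neg_variation \<mu>) A"
    if "A \<in> sets borel" for A
    using eq[OF that] jordan_decomposition[OF \<mu> that] P(1) N(1) fin
    by (simp add: finite_measure.emeasure_eq_measure flip: ennreal_plus)
  have main: "(\<integral>x. g x \<partial>pos_variation \<mu>) + (\<integral>x. g x \<partial>N) = (\<integral>x. g x \<partial>P) + (\<integral>x. g x \<partial>neg_variation \<mu>)"
    if g: "g \<in> borel_measurable borel" "\<And>x. 0 \<le> g x" "\<And>x. \<bar>g x\<bar> \<le> c" for g :: "'a \<Rightarrow> real"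
  proof -
    have int: "integrable (pos_variation \<mu>) g" "integrable (neg_variation \<mu>) g" "integrable P g" "integrable N g"
      using integrable_bounded[OF _ _ g(1,3)] fin P N by auto
    have "ennreal ((\<integral>x. g x \<partial>pos_variation \<mu>) + (\<integral>x. g x \<partial>N)) = ennreal ((\<integral>x. g x \<partial>P) + (\<integral>x. g x \<partial>neg_variation \<mu>))"
      using nn_integral_add_cong[OF _ _ P(2) N(2) meq, of "\<lambda>x. ennreal (g x)"] g(1,2) int
      by (simp add: nn_integral_eq_integral)
    then show ?thesis using g(2) by (subst (asm) ennreal_inj) (simp_all add: integral_nonneg_AE)
  qed
  define p n where "p = (\<lambda>x. max 0 (f x))" and "n = (\<lambda>x. max 0 (- f x))"
  have pn: "p \<in> borel_measurable borel" "n \<in> borel_measurable borel" "\<And>x. \<bar>p x\<bar> \<le> c" "\<And>x. \<bar>n x\<bar> \<le> c"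
      "\<And>x. 0 \<le> p x" "\<And>x. 0 \<le> n x"
    using f order_trans[OF abs_ge_zero f(2)] by (auto simp: p_def n_def abs_le_iff)
  have "f = (\<lambda>x. p x - n x)" by (auto simp: p_def n_def)
  moreover have "(\<integral>x. p x - n x \<partial>Q) = (\<integral>x. p x \<partial>Q) - (\<integral>x. n x \<partial>Q)" if "finite_measure Q" "sets Q = sets borel" for Q
    using integrable_bounded[OF that pn(1,3)] integrable_bounded[OF that pn(2,4)] by simp
  ultimately show ?thesis
    using main[OF pn(1,5,3)] main[OF pn(2,6,4)] fin P N by (simp add: signed_integral_def)
qed

text \<open>Here \<open>\<mu>\<close> is the image under \<open>X\<close> of the signed measure with
  density \<open>k\<close> against \<open>P\<close>. The measure \<open>Q 1\<close> carries the
  positive part of \<open>k\<close>, and \<open>Q (-1)\<close> the negative part.\<close>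

lemma signed_integral_pushforward:
  fixes X :: "'b \<Rightarrow> 'a::topological_space" and k :: "'b \<Rightarrow> real"
  assumes X: "X \<in> borel_measurable P" and k: "integrable P k"
    and eq: "\<And>A. A \<in> sets borel \<Longrightarrow> \<mu> A = (\<integral>w. indicator A (X w) * k w \<partial>P)"
  shows "\<mu> \<in> vector_measures"
    and "f \<in> borel_measurable borel \<Longrightarrow> (\<And>x. \<bar>f x\<bar> \<le> c) \<Longrightarrow> signed_integral \<mu> f = (\<integral>w. f (X w) * k w \<partial>P)"
proof -
  define Q where "Q s = distr (density P (\<lambda>w. ennreal (max 0 (s * k w)))) borel X" for s :: real
  have [measurable]: "k \<in> borel_measurable P" "X \<in> borel_measurable P" using k X by auto
  have sQ: "sets (Q s) = sets borel" for s by (simp add: Q_def)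
  have ik: "integrable P (\<lambda>w. max 0 (s * k w))" for s using k by simp
  have fQ: "finite_measure (Q s)" for s
  proof (rule finite_measureI)
    have "emeasure (Q s) (space (Q s)) = (\<integral>\<^sup>+w. ennreal (max 0 (s * k w)) \<partial>P)"
      by (simp add: Q_def emeasure_distr emeasure_density space_density cong: nn_integral_cong)
    also have "\<dots> = ennreal (\<integral>w. max 0 (s * k w) \<partial>P)" by (rule nn_integral_eq_integral[OF ik]) simp
    finally show "emeasure (Q s) (space (Q s)) \<noteq> \<infinity>" by simp
  qed
  have integral_Q: "(\<integral>x. g x \<partial>Q s) = (\<integral>w. max 0 (s * k w) * g (X w) \<partial>P)" if "g \<in> borel_measurable borel" for g :: "'a \<Rightarrow> real" and s
    using that unfolding Q_def by (subst integral_distr; (subst integral_real_density)?) auto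
  have diff: "(\<integral>x. g x \<partial>Q 1) - (\<integral>x. g x \<partial>Q (-1)) = (\<integral>w. g (X w) * k w \<partial>P)"
    if g: "g \<in> borel_measurable borel" "\<And>x. \<bar>g x\<bar> \<le> d" for g d
  proof -
    have int: "integrable P (\<lambda>w. max 0 (s * k w) * g (X w))" for s
    proof (rule Bochner_Integration.integrable_bound)
      show "integrable P (\<lambda>w. max 0 (s * k w) * d)" using ik by simp
      show "AE w in P. norm (max 0 (s * k w) * g (X w)) \<le> norm (max 0 (s * k w) * d)"
        using g(2) by (auto simp: abs_mult intro!: mult_left_mono order_trans[OF _ abs_ge_self])
    qed (use g(1) in measurable)
    have "(\<integral>x. g x \<partial>Q 1) - (\<integral>x. g x \<partial>Q (-1)) = (\<integral>w. max 0 (1 * k w) * g (X w) - max 0 (- 1 * k w) * g (X w) \<partial>P)"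
      unfolding integral_Q[OF g(1)] by (rule Bochner_Integration.integral_diff[symmetric]; rule int)
    also have "\<dots> = (\<integral>w. g (X w) * k w \<partial>P)"
      by (intro Bochner_Integration.integral_cong) (auto simp: max_def)
    finally show ?thesis .
  qed
  have eqQ: "\<mu> A = measure (Q 1) A - measure (Q (-1)) A" if "A \<in> sets borel" for A
    using diff[of "indicator A" 1] that eq[OF that] sQ by simp
  show \<mu>: "\<mu> \<in> vector_measures"
    using vector_measures_cong[OF eqQ vector_measures_measure_diff[OF fQ fQ sQ sQ]] by simp
  show "signed_integral \<mu> f = (\<integral>w. f (X w) * k w \<partial>P)" if "f \<in> borel_measurable borel" "\<And>x. \<bar>f x\<bar> \<le> c"
    using signed_integral_eq_diff[OF \<mu> fQ sQ fQ sQ eqQ that] diff[OF that] by simp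
qed

text \<open>A non-integrable function has integral 0 by default, so additivity of
  \<open>signed_integral\<close> calls for integrability against both variations.\<close>

definition signed_integrable :: "('a::topological_space set \<Rightarrow> real) \<Rightarrow> ('a \<Rightarrow> real) \<Rightarrow> bool" where
  "signed_integrable \<mu> f \<longleftrightarrow> integrable (pos_variation \<mu>) f \<and> integrable (neg_variation \<mu>) f"

lemma signed_integrable_bounded:
  assumes "\<mu> \<in> vector_measures" "f \<in> borel_measurable borel" "\<And>x. \<bar>f x\<bar> \<le> c"
  shows "signed_integrable \<mu> f"
  unfolding signed_integrable_def
  using integrable_bounded[OF finite_pos_variation[OF assms(1)] sets_pos_variation assms(2,3)]
    integrable_bounded[OF finite_neg_variation[OF assms(1)] sets_neg_variation assms(2,3)] by simp

lemma signed_integral_add: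
  "signed_integrable \<mu> f \<Longrightarrow> signed_integrable \<mu> g \<Longrightarrow>
    signed_integral \<mu> (\<lambda>x. f x + g x) = signed_integral \<mu> f + signed_integral \<mu> g"
  by (simp add: signed_integrable_def signed_integral_def)

lemma signed_integral_cmult: "signed_integral \<mu> (\<lambda>x. c * f x) = c * signed_integral \<mu> f"
  by (simp add: signed_integral_def right_diff_distrib)

lemma signed_integral_const:
  assumes "\<mu> \<in> vector_measures"
  shows "signed_integral \<mu> (\<lambda>x. c) = c * \<mu> UNIV"
  using jordan_decomposition[OF assms, of UNIV] by (simp add: signed_integral_def right_diff_distrib mult.commute)

lemma nn_integral_total_variation:
  fixes f :: "'a::topological_space \<Rightarrow> ennreal"
  assumes "f \<in> borel_measurable borel"
  shows "(\<integral>\<^sup>+x. f x \<partial>total_variation \<mu>) = (\<integral>\<^sup>+x. f x \<partial>pos_variation \<mu>) + (\<integral>\<^sup>+x. f x \<partial>neg_variation \<mu>)"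
  \<comment> \<open>The decomposition is read as total minus negative variation = positive variation
    minus 0.\<close>
  using nn_integral_add_cong[of "total_variation \<mu>" "neg_variation \<mu>" "pos_variation \<mu>" "null_measure borel" f] assms
  by (simp add: emeasure_total_variation nn_integral_null_measure)

section \<open>The functional on the maps with convergent derivative\<close>

lemma jacobian_eqI:
  fixes f :: "real^'n \<Rightarrow> real^'m"
  assumes "(f has_derivative (\<lambda>h. A *v h)) (at x)"
  shows "jacobian f (at x) = A"
  unfolding jacobian_def frechet_derivative_at[OF assms, symmetric] by (rule matrix_of_matrix_vector_mul)

lemma has_derivative_jacobian:
  fixes f :: "real^'n \<Rightarrow> real^'m"
  shows "f differentiable (at x) \<Longrightarrow> (f has_derivative (\<lambda>h. jacobian f (at x) *v h)) (at x)"
  by (simp flip: jacobian_works)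

lemma jacobian_nth:
  fixes f :: "real^'n \<Rightarrow> real^'m"
  shows "jacobian f (at x) $ i $ j = frechet_derivative f (at x) (axis j 1) $ i"
  by (simp add: jacobian_def matrix_def)

lemma C1_starD:
  assumes "u \<in> C1_star"
  shows "u differentiable at x" and "continuous_on UNIV (\<lambda>x. jacobian u (at x))"
    and "\<exists>L. ((\<lambda>x. jacobian u (at x)) \<longlongrightarrow> L) at_infinity"
  using assms by (auto simp: C1_star_def C1_def C_star_def)

lemma C1_starI:
  assumes "\<And>x. (u has_derivative (\<lambda>h. J x *v h)) (at x)" "continuous_on UNIV J" "(J \<longlongrightarrow> L) at_infinity"
  shows "u \<in> C1_star"
proof -
  have "(\<lambda>x. jacobian u (at x)) = J" using jacobian_eqI[OF assms(1)] by auto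
  then show ?thesis using assms by (auto simp: C1_star_def C1_def C_star_def differentiable_def)
qed

lemma C1_star_add:
  assumes u: "u \<in> C1_star" and v: "v \<in> C1_star"
  shows "(\<lambda>x. u x + v x) \<in> C1_star"
    and "deformation (\<lambda>x. u x + v x) x = deformation u x + deformation v x"
proof -
  have d: "((\<lambda>x. u x + v x) has_derivative (\<lambda>h. (jacobian u (at x) + jacobian v (at x)) *v h)) (at x)" for x
    using has_derivative_add[OF has_derivative_jacobian[OF C1_starD(1)[OF u]] has_derivative_jacobian[OF C1_starD(1)[OF v]]]
    by (simp add: matrix_vector_mult_add_rdistrib)
  obtain L1 L2 where "((\<lambda>x. jacobian u (at x)) \<longlongrightarrow> L1) at_infinity" "((\<lambda>x. jacobian v (at x)) \<longlongrightarrow> L2) at_infinity"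
    using C1_starD(3) u v by blast
  then show "(\<lambda>x. u x + v x) \<in> C1_star"
    using C1_starI[OF d continuous_on_add[OF C1_starD(2)[OF u] C1_starD(2)[OF v]] tendsto_add] by blast
  show "deformation (\<lambda>x. u x + v x) x = deformation u x + deformation v x"
    by (simp add: deformation_def jacobian_eqI[OF d] sym_part_def vec_eq_iff transpose_def algebra_simps)
qed

lemma C1_star_scaleR:
  assumes u: "u \<in> C1_star"
  shows "(\<lambda>x. c *\<^sub>R u x) \<in> C1_star"
    and "deformation (\<lambda>x. c *\<^sub>R u x) x = c *\<^sub>R deformation u x"
proof -
  have d: "((\<lambda>x. c *\<^sub>R u x) has_derivative (\<lambda>h. (c *\<^sub>R jacobian u (at x)) *v h)) (at x)" for x
    using has_derivative_scaleR_right[OF has_derivative_jacobian[OF C1_starD(1)[OF u]]]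
    by (simp add: scaleR_matrix_vector_assoc)
  obtain L where "((\<lambda>x. jacobian u (at x)) \<longlongrightarrow> L) at_infinity" using C1_starD(3)[OF u] by blast
  then show "(\<lambda>x. c *\<^sub>R u x) \<in> C1_star"
    using C1_starI[OF d continuous_on_scaleR[OF continuous_on_const C1_starD(2)[OF u]] tendsto_scaleR[OF tendsto_const]]
    by blast
  show "deformation (\<lambda>x. c *\<^sub>R u x) x = c *\<^sub>R deformation u x"
    by (simp add: deformation_def jacobian_eqI[OF d] sym_part_def vec_eq_iff transpose_def algebra_simps)
qed

lemma C1_star_id: "(\<lambda>x::real^'d. x) \<in> C1_star"
  and deformation_id: "deformation (\<lambda>x::real^'d. x) x = mat 1"
proof -
  have d: "((\<lambda>x. x) has_derivative (\<lambda>h. (mat 1 :: real^'d^'d) *v h)) (at x)" for x :: "real^'d" by simp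
  show "(\<lambda>x::real^'d. x) \<in> C1_star" by (rule C1_starI[OF d]) auto
  show "deformation (\<lambda>x::real^'d. x) x = mat 1"
    by (simp add: deformation_def jacobian_eqI[OF d] sym_part_def flip: scaleR_2)
qed

text \<open>The limit at infinity gives the bound outside a large ball, compactness gives it
  inside.\<close>

lemma C1_star_jacobian_bounded:
  fixes u :: "real^'d \<Rightarrow> real^'d"
  assumes u: "u \<in> C1_star"
  obtains B where "\<And>x. norm (jacobian u (at x)) \<le> B"
proof -
  let ?J = "\<lambda>x. jacobian u (at x)"
  obtain L where "(?J \<longlongrightarrow> L) at_infinity" using C1_starD(3)[OF u] by blast
  then have "\<forall>\<^sub>F x in at_infinity. dist (?J x) L < 1" by (rule tendstoD) simp
  then obtain R where R: "\<And>x. R \<le> norm x \<Longrightarrow> dist (?J x) L < 1" by (auto simp: eventually_at_infinity)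
  have "compact (?J ` cball 0 R)"
    by (intro compact_continuous_image continuous_on_subset[OF C1_starD(2)[OF u]]) auto
  then obtain B where B: "\<And>x. norm x \<le> R \<Longrightarrow> norm (?J x) \<le> B"
    by (force dest!: compact_imp_bounded simp: bounded_iff)
  have "norm (?J x) \<le> max B (norm L + 1)" for x
  proof (cases "norm x \<le> R")
    case True then show ?thesis using B[of x] by simp
  next
    case False
    then have "dist (?J x) L < 1" using R[of x] by simp
    then show ?thesis using norm_triangle_sub[of "?J x" L] by (simp add: dist_norm)
  qed
  then show ?thesis using that by blast
qed

lemma matrix_component_le_norm: "\<bar>A $ i $ j\<bar> \<le> norm A" for A :: "real^'n^'m"
  by (rule order_trans[OF component_le_norm_cart Finite_Cartesian_Product.norm_nth_le])

text \<open>The mean value inequality with a bounded Jacobian. Linear growth is what the finite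
  first moment of \<open>F\<close> can integrate.\<close>

lemma C1_star_linear_growth:
  fixes u :: "real^'d \<Rightarrow> real^'d"
  assumes u: "u \<in> C1_star"
  obtains a b where "\<And>x. norm (u x) \<le> a + b * norm x"
proof -
  obtain B where B: "\<And>x. norm (jacobian u (at x)) \<le> B" using C1_star_jacobian_bounded[OF u] by blast
  define b where "b = (\<Sum>i\<in>(UNIV::'d set). \<Sum>j\<in>(UNIV::'d set). B)"
  have "onorm (\<lambda>h. jacobian u (at x) *v h) \<le> b" for x
  proof -
    have "onorm (\<lambda>h. jacobian u (at x) *v h) \<le> (\<Sum>i\<in>UNIV. \<Sum>j\<in>UNIV. \<bar>jacobian u (at x) $ i $ j\<bar>)"
      by (rule onorm_le_matrix_component_sum)
    also have "\<dots> \<le> b"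
      unfolding b_def by (intro sum_mono order_trans[OF matrix_component_le_norm B])
    finally show ?thesis .
  qed
  then have "norm (u x - u 0) \<le> b * norm (x - 0)" for x
    using has_derivative_jacobian[OF C1_starD(1)[OF u]]
    by (intro differentiable_bound[of UNIV u "\<lambda>x h. jacobian u (at x) *v h"]) auto
  then have "norm (u x) \<le> norm (u 0) + b * norm x" for x
    using norm_triangle_sub[of "u x" "u 0"] by (smt (verit) diff_zero)
  then show ?thesis using that by blast
qed

lemma deformation_nth:
  "deformation u x $ i $ j = (jacobian u (at x) $ i $ j + jacobian u (at x) $ j $ i) / 2"
  by (simp add: deformation_def sym_part_def transpose_def)

lemma continuous_on_deformation:
  "u \<in> C1_star \<Longrightarrow> continuous_on UNIV (\<lambda>x. deformation u x $ i $ j)"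
  unfolding deformation_nth by (intro continuous_intros C1_starD) auto

lemma C1_star_deformation_bounded:
  assumes "u \<in> C1_star"
  obtains B where "\<And>x i j. \<bar>deformation u x $ i $ j\<bar> \<le> B"
proof -
  obtain B where B: "\<And>x. norm (jacobian u (at x)) \<le> B" using C1_star_jacobian_bounded[OF assms] by blast
  have bound: "\<bar>jacobian u (at x) $ i $ j\<bar> \<le> B" for x i j
    by (rule order_trans[OF matrix_component_le_norm B])
  have "\<bar>deformation u x $ i $ j\<bar> \<le> B" for x i j
    using bound[of x i j] bound[of x j i] unfolding deformation_nth add_divide_distrib by linarith
  then show ?thesis using that by blast
qed

section \<open>Quadratic forms and monotone maps\<close>

definition quad_form :: "real^'d^'d \<Rightarrow> real^'d \<Rightarrow> real" where
  "quad_form A v = (\<Sum>i\<in>UNIV. \<Sum>j\<in>UNIV. A $ i $ j * v $ i * v $ j)"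

lemma quad_form_add: "quad_form (A + B) v = quad_form A v + quad_form B v"
  by (simp add: quad_form_def sum.distrib algebra_simps)

lemma quad_form_scaleR: "quad_form (c *\<^sub>R A) v = c * quad_form A v"
  by (simp add: quad_form_def sum_distrib_left mult.assoc)

lemma quad_form_scaleR_vector: "quad_form A (c *\<^sub>R v) = c\<^sup>2 * quad_form A v"
  by (simp add: quad_form_def sum_distrib_left power2_eq_square mult_ac)

lemma quad_form_mat_1: "quad_form (mat 1) v = (norm v)\<^sup>2"
proof -
  have "quad_form (mat 1) v = (\<Sum>i\<in>UNIV. \<Sum>j\<in>UNIV. if j = i then v $ i * v $ j else 0)"
    unfolding quad_form_def by (intro sum.cong) (auto simp: mat_def)
  then show ?thesis by (simp add: power2_norm_eq_inner inner_vec_def)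
qed

text \<open>Exchanging the indices shows that the antisymmetric part of \<open>A\<close> contributes
  nothing.\<close>

lemma quad_form_sym_part: "quad_form (sym_part A) v = v \<bullet> (A *v v)"
proof -
  have "v \<bullet> (A *v v) = (\<Sum>i\<in>UNIV. \<Sum>j\<in>UNIV. A $ i $ j * v $ i * v $ j)"
    by (simp add: inner_vec_def matrix_vector_mult_def sum_distrib_left mult_ac)
  moreover from this have "v \<bullet> (A *v v) = (\<Sum>i\<in>UNIV. \<Sum>j\<in>UNIV. A $ j $ i * v $ i * v $ j)"
    by (subst sum.swap) (simp add: mult_ac)
  ultimately have "v \<bullet> (A *v v) + v \<bullet> (A *v v) =
      (\<Sum>i\<in>UNIV. \<Sum>j\<in>UNIV. A $ i $ j * v $ i * v $ j + A $ j $ i * v $ i * v $ j)"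
    by (simp add: sum.distrib)
  also have "\<dots> = 2 * quad_form (sym_part A) v"
    unfolding quad_form_def sum_distrib_left
    by (intro sum.cong refl) (simp add: sym_part_def transpose_def algebra_simps)
  finally show ?thesis by simp
qed

text \<open>Along the segment from \<open>y\<close> to \<open>x\<close>, the component of
  \<open>w\<close> in direction \<open>x - y\<close> has as derivative the quadratic form of the
  deformation tensor at \<open>x - y\<close>, so it does not decrease.\<close>

lemma monotone_mapI_deformation:
  fixes w :: "real^'d \<Rightarrow> real^'d"
  assumes diff: "\<And>x. w differentiable at x" and psd: "\<And>x v. 0 \<le> quad_form (deformation w x) v"
  shows "monotone_map w"
  unfolding monotone_map_def
proof (intro allI)
  fix x y
  define g where "g t = w (y + t *\<^sub>R (x - y)) \<bullet> (x - y)" for t :: real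
  have "(g has_real_derivative (x - y) \<bullet> (jacobian w (at (y + t *\<^sub>R (x - y))) *v (x - y))) (at t)" for t
  proof -
    have "((\<lambda>t. y + t *\<^sub>R (x - y)) has_derivative (\<lambda>s. s *\<^sub>R (x - y))) (at t)"
      by (auto intro!: derivative_eq_intros)
    from has_derivative_inner_left[OF has_derivative_compose[OF this has_derivative_jacobian[OF diff]]]
    show ?thesis
      unfolding g_def has_field_derivative_def
      by (rule has_derivative_eq_rhs) (auto simp: matrix_vector_mult_scaleR inner_commute mult.commute)
  qed
  then have "\<exists>d. (g has_real_derivative d) (at t) \<and> 0 \<le> d" for t
    using psd[of "y + t *\<^sub>R (x - y)" "x - y"] unfolding deformation_def quad_form_sym_part by blast
  then have "g 0 \<le> g 1" by (intro DERIV_nonneg_imp_nondecreasing[of 0 1 g]) simp_all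
  then show "0 \<le> (w x - w y) \<bullet> (x - y)" by (simp add: g_def inner_diff_left)
qed

lemma test_functions_outside_support:
  fixes u :: "real^'d \<Rightarrow> real^'d"
  assumes "x \<notin> closure {x. u x \<noteq> 0}"
  shows "jacobian u (at x) = 0"
proof (rule jacobian_eqI)
  have "((\<lambda>_. 0) has_derivative (\<lambda>h. (0 :: real^'d^'d) *v h)) (at x)" by simp
  then show "(u has_derivative (\<lambda>h. 0 *v h)) (at x)"
    by (rule has_derivative_transform_within_open[where s="- closure {x. u x \<noteq> 0}"])
      (use assms closure_subset[of "{x. u x \<noteq> 0}"] in auto)
qed

lemma test_functions_subset_C1_star: "test_functions \<subseteq> C1_star"
proof
  fix u :: "real^'d \<Rightarrow> real^'d" assume u: "u \<in> test_functions"
  then have "k_smooth (Suc 0) u" and K: "compact (closure {x. u x \<noteq> 0})" by (auto simp: test_functions_def)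
  then have diff: "\<And>x. u differentiable at x" and cont: "\<And>v. continuous_on UNIV (\<lambda>x. frechet_derivative u (at x) v)"
    by auto
  have "continuous_on UNIV (\<lambda>x. \<chi> i j. jacobian u (at x) $ i $ j)"
    unfolding jacobian_nth by (intro continuous_on_vec_lambda continuous_on_component cont)
  then have J: "continuous_on UNIV (\<lambda>x. jacobian u (at x))" by simp
  obtain R where "\<And>x. x \<in> closure {x. u x \<noteq> 0} \<Longrightarrow> norm x \<le> R"
    using compact_imp_bounded[OF K] by (auto simp: bounded_iff)
  then have "jacobian u (at x) = 0" if "R + 1 \<le> norm x" for x
    using that test_functions_outside_support[of x u] by force
  then have "\<forall>\<^sub>F x in at_infinity. jacobian u (at x) = 0" by (auto simp: eventually_at_infinity)
  then have "((\<lambda>x. jacobian u (at x)) \<longlongrightarrow> 0) at_infinity" by (rule tendsto_eventually)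
  then show "u \<in> C1_star" using has_derivative_jacobian[OF diff] J by (rule C1_starI[rotated 2])
qed

section \<open>Integrability and linearity of the functional\<close>

lemma signed_integrable_norm:
  assumes "finite_first_moment F"
  shows "signed_integrable (\<lambda>A. F A $ i) norm"
proof -
  have "(\<integral>\<^sup>+x. ennreal (norm x) \<partial>total_variation (\<lambda>A. F A $ i)) < \<infinity>"
    using assms by (simp add: finite_first_moment_def)
  then have "(\<integral>\<^sup>+x. ennreal (norm x) \<partial>pos_variation (\<lambda>A. F A $ i)) < \<infinity>"
      "(\<integral>\<^sup>+x. ennreal (norm x) \<partial>neg_variation (\<lambda>A. F A $ i)) < \<infinity>"
    by (simp_all add: nn_integral_total_variation)
  then show ?thesis by (simp add: signed_integrable_def integrable_iff_bounded)
qed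

lemma vector_measures_trace:
  "M \<in> vector_measures \<Longrightarrow> (\<lambda>A. trace (M A)) \<in> vector_measures"
  unfolding trace_def
  by (rule vector_measures_linear_image[where f="\<lambda>A. \<Sum>i\<in>UNIV. A $ i $ i"])
    (intro bounded_linear_sum bounded_linear_compose[OF bounded_linear_vec_nth bounded_linear_vec_nth])

context
  fixes F :: "(real^'d) set \<Rightarrow> real^'d" and H :: "(real^'d) set \<Rightarrow> real^'d^'d"
  assumes F: "F \<in> vector_measures" "finite_first_moment F" and H: "H \<in> vector_measures"
begin

lemma vector_measures_F: "(\<lambda>A. F A $ i) \<in> vector_measures"
  by (rule vector_measures_linear_image[OF bounded_linear_vec_nth F(1)])

lemma vector_measures_H: "(\<lambda>A. H A $ i $ j) \<in> vector_measures"
  by (rule vector_measures_linear_image[OF bounded_linear_vec_nth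
      vector_measures_linear_image[OF bounded_linear_vec_nth H]])

lemma signed_integrable_F:
  assumes u: "u \<in> C1_star"
  shows "signed_integrable (\<lambda>A. F A $ i) (\<lambda>x. u x $ i)"
proof -
  obtain a b where ab: "\<And>x. norm (u x) \<le> a + b * norm x" using C1_star_linear_growth[OF u] by blast
  have "continuous_on UNIV u"
    using C1_starD(1)[OF u] by (simp add: continuous_on_eq_continuous_at differentiable_imp_continuous_within)
  then have m: "(\<lambda>x. u x $ i) \<in> borel_measurable borel"
    by (intro borel_measurable_continuous_onI continuous_intros)
  have "integrable Q (\<lambda>x. u x $ i)"
    if Q: "finite_measure Q" "sets Q = sets borel" "integrable Q norm" for Q :: "(real^'d) measure"
  proof (rule Bochner_Integration.integrable_bound)
    show "integrable Q (\<lambda>x. a + b * norm x)"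
      using Q by (intro Bochner_Integration.integrable_add finite_measure.integrable_const) auto
    show "(\<lambda>x. u x $ i) \<in> borel_measurable Q" using m Q(2) by (simp cong: measurable_cong_sets)
    show "AE x in Q. norm (u x $ i) \<le> norm (a + b * norm x)"
      using order_trans[OF component_le_norm_cart order_trans[OF ab abs_ge_self]] by simp
  qed
  then show ?thesis
    using signed_integrable_norm[OF F(2), of i] finite_pos_variation[OF vector_measures_F] finite_neg_variation[OF vector_measures_F]
    by (simp add: signed_integrable_def)
qed

lemma signed_integrable_H:
  assumes u: "u \<in> C1_star"
  shows "signed_integrable (\<lambda>A. H A $ i $ j) (\<lambda>x. deformation u x $ i $ j)"
proof -
  obtain B where "\<And>x i j. \<bar>deformation u x $ i $ j\<bar> \<le> B" using C1_star_deformation_bounded[OF u] by blast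
  then show ?thesis
    by (intro signed_integrable_bounded[OF vector_measures_H] borel_measurable_continuous_onI continuous_on_deformation u)
qed

lemma G_add:
  assumes "u \<in> C1_star" "v \<in> C1_star"
  shows "G F H (\<lambda>x. u x + v x) = G F H u + G F H v"
  using assms
  by (simp add: G_def vec_integral_def mat_integral_def C1_star_add signed_integral_add
      signed_integrable_F signed_integrable_H sum.distrib)

lemma G_scaleR:
  assumes "u \<in> C1_star"
  shows "G F H (\<lambda>x. c *\<^sub>R u x) = c * G F H u"
  using assms
  by (simp add: G_def vec_integral_def mat_integral_def C1_star_scaleR signed_integral_cmult
      sum_distrib_left right_diff_distrib)

text \<open>The value at the identity is exactly the bound claimed for the trace of the representing
  measure.\<close>

lemma G_id: "G F H (\<lambda>x. x) = - vec_integral F (\<lambda>x. x) - trace_integral H"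
proof -
  have "mat_integral H (deformation (\<lambda>x. x)) = (\<Sum>i\<in>UNIV. \<Sum>j\<in>UNIV. if j = i then H UNIV $ i $ j else 0)"
    unfolding mat_integral_def deformation_id signed_integral_const[OF vector_measures_H]
    by (intro sum.cong refl) (auto simp: mat_def)
  also have "\<dots> = trace (H UNIV)" by (simp add: trace_def)
  also have "\<dots> = trace_integral H"
    using signed_integral_const[OF vector_measures_trace[OF H]] by (simp add: trace_integral_def)
  finally show ?thesis by (simp add: G_def)
qed

end

section \<open>Matrix measures from second moments\<close>

text \<open>The cutoff is 1 on the unit sphere and satisfies \<open>(norm \<xi>)\<^sup>2 * cutoff \<xi> \<le> 1\<close> everywhere. The weights
  \<open>\<xi> $ i * \<xi> $ j * cutoff \<xi>\<close> therefore agree with \<open>\<xi> $ i * \<xi> $ j\<close> on the sphere, but have compact support and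
  no contribution to the trace exceeding the total mass.\<close>

definition cutoff :: "'a::real_inner \<Rightarrow> real" where
  "cutoff \<xi> = max 0 (2 - (norm \<xi>)\<^sup>2)"

lemma cutoff_nonneg: "0 \<le> cutoff \<xi>"
  and cutoff_unit: "norm \<xi> = 1 \<Longrightarrow> cutoff \<xi> = 1"
  and cutoff_outside: "2 \<le> norm \<xi> \<Longrightarrow> cutoff \<xi> = 0"
  and continuous_on_cutoff [continuous_intros]: "continuous_on S f \<Longrightarrow> continuous_on S (\<lambda>x. cutoff (f x))"
proof -
  show "cutoff \<xi> = 0" if "2 \<le> norm \<xi>"
    using power_mono[OF that, of 2] by (simp add: cutoff_def)
qed (auto simp: cutoff_def intro!: continuous_intros)

lemma norm_power2_cutoff_le: "(norm \<xi>)\<^sup>2 * cutoff \<xi> \<le> 1"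
proof -
  have "1 - r * (2 - r) = (1 - r)\<^sup>2" for r :: real by (simp add: power2_eq_square algebra_simps)
  then have "r * (2 - r) \<le> 1" for r :: real by (metis diff_ge_0_iff_ge zero_le_power2)
  then show ?thesis by (simp add: cutoff_def max_def)
qed

definition weight :: "'d \<Rightarrow> 'd \<Rightarrow> real^'d \<Rightarrow> real" where
  "weight i j \<xi> = \<xi> $ i * \<xi> $ j * cutoff \<xi>"

lemma abs_weight_le: "\<bar>weight i j \<xi>\<bar> \<le> 1"
proof -
  have "\<bar>weight i j \<xi>\<bar> = \<bar>\<xi> $ i\<bar> * \<bar>\<xi> $ j\<bar> * cutoff \<xi>"
    by (simp add: weight_def abs_mult cutoff_nonneg)
  also have "\<dots> \<le> norm \<xi> * norm \<xi> * cutoff \<xi>"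
    by (intro mult_right_mono mult_mono component_le_norm_cart cutoff_nonneg) auto
  also have "\<dots> \<le> 1" using norm_power2_cutoff_le[of \<xi>] by (simp add: power2_eq_square)
  finally show ?thesis .
qed

lemma continuous_on_weight: "continuous_on UNIV (weight i j)"
  unfolding weight_def by (intro continuous_intros)

lemma sum_weight_quad_form: "(\<Sum>i\<in>UNIV. \<Sum>j\<in>UNIV. A $ i $ j * weight i j \<xi>) = quad_form A \<xi> * cutoff \<xi>"
  by (simp add: quad_form_def weight_def sum_distrib_right mult.assoc)

definition moment_matrix :: "((real^'d) \<times> (real^'d)) measure \<Rightarrow> (real^'d) set \<Rightarrow> real^'d^'d" where
  "moment_matrix P A = (\<chi> i j. \<integral>z. indicator A (fst z) * weight i j (snd z) \<partial>P)"

context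
  fixes P :: "((real^'d) \<times> (real^'d)) measure"
  assumes P: "finite_measure P" "sets P = sets borel"
begin

lemma measurable_P:
  "f \<in> borel_measurable borel \<Longrightarrow> f \<in> borel_measurable P"
  using P(2) by (simp cong: measurable_cong_sets)

lemma measurable_fst_P: "fst \<in> borel_measurable P"
  by (intro measurable_P borel_measurable_continuous_onI continuous_intros)

lemma measurable_weight: "(\<lambda>z. weight i j (snd z)) \<in> borel_measurable P"
  by (intro measurable_P borel_measurable_continuous_onI
      continuous_on_compose2[OF continuous_on_weight continuous_on_snd]) (auto intro: continuous_on_id)

lemma integrable_weight: "integrable P (\<lambda>z. f (fst z) * weight i j (snd z))"
  if "f \<in> borel_measurable borel" "\<And>x. \<bar>f x\<bar> \<le> c"
proof (rule finite_measure.integrable_const_bound[OF P(1), where B=c])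
  have "\<bar>f x\<bar> * \<bar>weight i j \<xi>\<bar> \<le> c" for x \<xi>
    using mult_mono[OF that(2) abs_weight_le] order_trans[OF abs_ge_zero that(2)] by simp
  then show "AE z in P. norm (f (fst z) * weight i j (snd z)) \<le> c" by (simp add: abs_mult)
  show "(\<lambda>z. f (fst z) * weight i j (snd z)) \<in> borel_measurable P"
    by (intro borel_measurable_times measurable_weight measurable_compose[OF measurable_fst_P that(1)])
qed

lemma integrable_indicator_weight: "A \<in> sets borel \<Longrightarrow> integrable P (\<lambda>z. indicator A (fst z) * weight i j (snd z))"
  by (rule integrable_weight[where c=1]) (auto simp: indicator_def)

lemma integrable_weight_snd: "integrable P (\<lambda>z. weight i j (snd z))"
  using integrable_weight[of "\<lambda>_. 1" 1] by simp

lemma signed_integral_moment_matrix: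
  shows "(\<lambda>A. moment_matrix P A $ i $ j) \<in> vector_measures"
    and "f \<in> borel_measurable borel \<Longrightarrow> (\<And>x. \<bar>f x\<bar> \<le> c) \<Longrightarrow>
      signed_integral (\<lambda>A. moment_matrix P A $ i $ j) f = (\<integral>z. f (fst z) * weight i j (snd z) \<partial>P)"
proof -
  note * = signed_integral_pushforward[OF measurable_fst_P integrable_weight_snd,
      of "\<lambda>A. moment_matrix P A $ i $ j" i j]
  show "(\<lambda>A. moment_matrix P A $ i $ j) \<in> vector_measures"
    by (rule *(1)) (simp add: moment_matrix_def)
  show "signed_integral (\<lambda>A. moment_matrix P A $ i $ j) f = (\<integral>z. f (fst z) * weight i j (snd z) \<partial>P)"
    if "f \<in> borel_measurable borel" "\<And>x. \<bar>f x\<bar> \<le> c"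
    by (rule *(2)[OF _ that]) (simp add: moment_matrix_def)
qed

text \<open>Tested against \<open>v\<close>, the second moments become the integral of the squared
  inner product of \<open>v\<close> with the fibre variable, times nonnegative factors.\<close>

lemma moment_matrix_psd: "moment_matrix P \<in> psd_measures"
proof -
  have "moment_matrix P \<in> vector_measures"
    by (intro vector_measures_vecI signed_integral_moment_matrix)
  moreover have "transpose (moment_matrix P A) = moment_matrix P A" for A
    by (simp add: moment_matrix_def transpose_def weight_def vec_eq_iff mult_ac)
  moreover have "0 \<le> (\<Sum>i\<in>UNIV. \<Sum>j\<in>UNIV. moment_matrix P A $ i $ j * v $ i * v $ j)" if A: "A \<in> sets borel" for v A
  proof -
    have "(\<Sum>i\<in>UNIV. \<Sum>j\<in>UNIV. moment_matrix P A $ i $ j * v $ i * v $ j) =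
        (\<integral>z. (\<Sum>i\<in>UNIV. \<Sum>j\<in>UNIV. indicator A (fst z) * weight i j (snd z) * v $ i * v $ j) \<partial>P)"
      using integrable_indicator_weight[OF A] by (simp add: moment_matrix_def)
    also have "\<dots> = (\<integral>z. indicator A (fst z) * cutoff (snd z) * (\<Sum>i\<in>UNIV. snd z $ i * v $ i)\<^sup>2 \<partial>P)"
      by (intro Bochner_Integration.integral_cong refl)
        (simp add: weight_def power2_eq_square sum_product sum_distrib_left mult_ac)
    also have "\<dots> \<ge> 0" by (intro integral_nonneg_AE) (simp add: cutoff_nonneg)
    finally show ?thesis .
  qed
  ultimately show ?thesis by (simp add: psd_measures_def sym_measures_def)
qed

lemma mat_integral_moment_matrix:
  assumes meas: "\<And>i j. (\<lambda>x. w x $ i $ j) \<in> borel_measurable borel" and bound: "\<And>x i j. \<bar>w x $ i $ j\<bar> \<le> B"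
  shows "mat_integral (moment_matrix P) w = (\<integral>z. quad_form (w (fst z)) (snd z) * cutoff (snd z) \<partial>P)"
proof -
  have "mat_integral (moment_matrix P) w = (\<Sum>i\<in>UNIV. \<Sum>j\<in>UNIV. \<integral>z. w (fst z) $ i $ j * weight i j (snd z) \<partial>P)"
    unfolding mat_integral_def using signed_integral_moment_matrix(2)[OF meas bound] by simp
  also have "\<dots> = (\<integral>z. (\<Sum>i\<in>UNIV. \<Sum>j\<in>UNIV. w (fst z) $ i $ j * weight i j (snd z)) \<partial>P)"
    using integrable_weight[OF meas bound] by simp
  finally show ?thesis by (simp add: sum_weight_quad_form)
qed

text \<open>Nothing says here that \<open>P\<close> is concentrated on the unit sphere;
  \<open>norm_power2_cutoff_le\<close> takes the place of \<open>norm \<xi> = 1\<close>.\<close>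

lemma trace_integral_moment_matrix_le: "trace_integral (moment_matrix P) \<le> measure P UNIV"
proof -
  have vm: "(\<lambda>A. trace (moment_matrix P A)) \<in> vector_measures"
    by (rule vector_measures_trace) (intro vector_measures_vecI signed_integral_moment_matrix)
  have "trace_integral (moment_matrix P) = (\<Sum>i\<in>UNIV. \<integral>z. weight i i (snd z) \<partial>P)"
    unfolding trace_integral_def signed_integral_const[OF vm] by (simp add: trace_def moment_matrix_def)
  also have "\<dots> = (\<integral>z. (\<Sum>i\<in>UNIV. weight i i (snd z)) \<partial>P)"
    using integrable_weight_snd by simp
  also have "\<dots> \<le> (\<integral>z. 1 \<partial>P)"
  proof (rule integral_mono)
    show "(\<Sum>i\<in>UNIV. weight i i (snd z)) \<le> 1" for z
      using norm_power2_cutoff_le[of "snd z"]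
      by (simp add: weight_def power2_norm_eq_inner inner_vec_def flip: sum_distrib_right)
  qed (use integrable_weight_snd finite_measure.integrable_const[OF P(1)] in auto)
  also have "\<dots> = measure P UNIV" using sets_eq_imp_space_eq[OF P(2)] by simp
  finally show ?thesis .
qed

end

section \<open>The representing measure\<close>

text \<open>The value at \<open>h\<close> of the functional below is an infimum over the maps \<open>w\<close> whose deformation tensor, as a family
  of quadratic forms on the unit sphere, dominates \<open>h\<close>. A linear functional below it is automatically
  positive, and agrees with \<open>G\<close> on the quadratic forms of deformation tensors.\<close>

definition majorizes :: "(real^'d \<Rightarrow> real^'d) \<Rightarrow> (((real^'d) \<times> (real^'d)) \<Rightarrow>\<^sub>C real) \<Rightarrow> bool" where
  "majorizes w h \<longleftrightarrow>
    (\<forall>x \<xi>. norm \<xi> = 1 \<longrightarrow> apply_bcontfun h (x, \<xi>) \<le> quad_form (deformation w x) \<xi>)"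

definition majorant_values ::
    "((real^'d) set \<Rightarrow> real^'d) \<Rightarrow> ((real^'d) set \<Rightarrow> real^'d^'d) \<Rightarrow> (((real^'d) \<times> (real^'d)) \<Rightarrow>\<^sub>C real) \<Rightarrow> real set" where
  "majorant_values F H h = {G F H w | w. w \<in> C1_star \<and> majorizes w h}"

context
  fixes F :: "(real^'d) set \<Rightarrow> real^'d" and H :: "(real^'d) set \<Rightarrow> real^'d^'d"
  assumes F: "F \<in> vector_measures" "finite_first_moment F" and H: "H \<in> vector_measures"
    and MON: "\<And>u. u \<in> MON \<Longrightarrow> 0 \<le> G F H u"
begin

text \<open>Subtracting \<open>c\<close> times the identity leaves a map with positive semidefinite
  tensor, hence a member of \<open>MON\<close>. This is where the positivity hypothesis on
  \<open>G\<close> enters.\<close>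

lemma G_ge:
  assumes w: "w \<in> C1_star" and c: "\<And>x \<xi>. norm \<xi> = 1 \<Longrightarrow> c \<le> quad_form (deformation w x) \<xi>"
  shows "c * G F H (\<lambda>x. x) \<le> G F H w"
proof -
  define v where "v = (\<lambda>x. w x + (- c) *\<^sub>R x)"
  note id = C1_star_scaleR[OF C1_star_id, of "- c"]
  have v: "v \<in> C1_star" unfolding v_def by (intro C1_star_add w id)
  have def: "deformation v x = deformation w x + (- c) *\<^sub>R mat 1" for x
    unfolding v_def by (simp only: C1_star_add(2)[OF w id(1)] id(2) deformation_id)
  have "0 \<le> quad_form (deformation v x) \<xi>" for x \<xi>
  proof (cases "\<xi> = 0")
    case True then show ?thesis by (simp add: quad_form_def)
  next
    case False
    \<comment> \<open>The lower bound \<open>c\<close> is known for unit vectors; homogeneity of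
      degree 2 carries the sign over to every \<open>\<xi>\<close>.\<close>
    define e where "e = (1 / norm \<xi>) *\<^sub>R \<xi>"
    have e: "norm e = 1" "\<xi> = norm \<xi> *\<^sub>R e" using False by (auto simp: e_def)
    have "quad_form (deformation v x) e = quad_form (deformation w x) e - c"
      unfolding def quad_form_add quad_form_scaleR quad_form_mat_1 by (simp add: e(1))
    then have "0 \<le> quad_form (deformation v x) e" using c[OF e(1)] by simp
    then show ?thesis by (subst e(2)) (simp add: quad_form_scaleR_vector)
  qed
  then have "v \<in> MON" using v by (auto simp: MON_def intro: monotone_mapI_deformation C1_starD)
  then have "0 \<le> G F H v" by (rule MON)
  also have "G F H v = G F H w + - c * G F H (\<lambda>x. x)"
    unfolding v_def G_add[OF F H w id(1)] G_scaleR[OF F H C1_star_id] ..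
  finally show ?thesis by simp
qed

lemma majorant_valuesI:
  "w \<in> C1_star \<Longrightarrow> majorizes w h \<Longrightarrow> G F H w \<in> majorant_values F H h"
  by (auto simp: majorant_values_def)

lemma majorant_valuesE:
  assumes "a \<in> majorant_values F H h"
  obtains w where "w \<in> C1_star" "majorizes w h" "a = G F H w"
  using assms by (auto simp: majorant_values_def)

text \<open>On the sphere the tensor of any majorizing map is at least the constant
  \<open>- norm h\<close>.\<close>

lemma bdd_below_majorant_values: "bdd_below (majorant_values F H h)"
proof (rule bdd_belowI)
  fix a assume "a \<in> majorant_values F H h"
  then obtain w where w: "w \<in> C1_star" "majorizes w h" "a = G F H w" by (rule majorant_valuesE)
  have "- norm h \<le> h z" for z using abs_bcontfun_le[of h z] by simp
  then have "- norm h \<le> quad_form (deformation w x) \<xi>" if "norm \<xi> = 1" for x \<xi>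
    using w(2) that unfolding majorizes_def by (meson order_trans)
  from G_ge[OF w(1) this] show "- norm h * G F H (\<lambda>x. x) \<le> a" using w(3) by simp
qed

text \<open>The order-unit property: on the sphere the tensor of \<open>c\<close> times the identity
  is the constant \<open>c\<close>. It makes the infimum range over a nonempty set, yields
  positivity for \<open>c = 0\<close> and the bound on the total mass for
  \<open>c = 1\<close>.\<close>

lemma scaled_id_majorant:
  assumes "\<And>z. apply_bcontfun h z \<le> c"
  shows "c * G F H (\<lambda>x. x) \<in> majorant_values F H h"
  unfolding G_scaleR[OF F H C1_star_id, symmetric]
proof (rule majorant_valuesI)
  show "majorizes (\<lambda>x. c *\<^sub>R x) h"
    using assms by (simp add: majorizes_def C1_star_scaleR[OF C1_star_id] deformation_id quad_form_scaleR quad_form_mat_1)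
qed (rule C1_star_scaleR[OF C1_star_id])

lemma sublinear_Inf_majorant_values: "sublinear (\<lambda>h. Inf (majorant_values F H h))"
proof (rule sublinear_Inf[OF bdd_below_majorant_values])
  show "majorant_values F H h \<noteq> {}" for h
  proof -
    have "h z \<le> norm h" for z using abs_bcontfun_le[of h z] by simp
    then show ?thesis using scaled_id_majorant by blast
  qed
  show "0 \<in> majorant_values F H 0" using scaled_id_majorant[of 0 0] by simp
  show "0 \<le> a" if "a \<in> majorant_values F H 0" for a
    using that G_ge[of _ 0] by (auto simp: majorizes_def elim!: majorant_valuesE)
next
  fix h k a b assume a: "a \<in> majorant_values F H h" and b: "b \<in> majorant_values F H k"
  obtain v where v: "v \<in> C1_star" "majorizes v h" "a = G F H v" using a by (rule majorant_valuesE)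
  obtain w where w: "w \<in> C1_star" "majorizes w k" "b = G F H w" using b by (rule majorant_valuesE)
  have "majorizes (\<lambda>x. v x + w x) (h + k)"
    using v w by (simp add: majorizes_def C1_star_add quad_form_add add_mono)
  then have "G F H (\<lambda>x. v x + w x) \<in> majorant_values F H (h + k)"
    using v w by (intro majorant_valuesI C1_star_add)
  then show "\<exists>c\<in>majorant_values F H (h + k). c \<le> a + b"
    unfolding G_add[OF F H v(1) w(1)] using v w by auto
next
  fix c h a assume c: "(0::real) < c" and "a \<in> majorant_values F H h"
  then obtain v where v: "v \<in> C1_star" "majorizes v h" "a = G F H v" by (blast elim: majorant_valuesE)
  have "majorizes (\<lambda>x. c *\<^sub>R v x) (c *\<^sub>R h)"
    using v c by (simp add: majorizes_def C1_star_scaleR quad_form_scaleR)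
  then have "G F H (\<lambda>x. c *\<^sub>R v x) \<in> majorant_values F H (c *\<^sub>R h)"
    using v by (intro majorant_valuesI C1_star_scaleR)
  then show "\<exists>b\<in>majorant_values F H (c *\<^sub>R h). b \<le> c * a"
    unfolding G_scaleR[OF F H v(1)] using v by auto
qed

lemma psd_representation:
  "\<exists>M\<in>psd_measures. (\<forall>u\<in>test_functions. G F H u = mat_integral M (deformation u)) \<and>
    trace_integral M \<le> G F H (\<lambda>x. x)"
proof -
  obtain L where L: "linear L" "\<And>h. L h \<le> Inf (majorant_values F H h)"
    using sublinear_dominates_linear[OF sublinear_Inf_majorant_values] by blast
  have L_le: "L h \<le> a" if "a \<in> majorant_values F H h" for a h
    using L(2) cInf_lower[OF that bdd_below_majorant_values] by (rule order_trans)
  interpret positive_functional L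
  proof
    fix h :: "((real^'d) \<times> (real^'d)) \<Rightarrow>\<^sub>C real" assume "\<And>z. 0 \<le> apply_bcontfun h z"
    \<comment> \<open>The zero map majorizes \<open>- h\<close>.\<close>
    then have "L (- h) \<le> 0" using L_le[OF scaled_id_majorant[of "- h" 0]] by simp
    then show "0 \<le> L h" using linear_neg[OF L(1)] by simp
  qed (simp_all add: linear_add[OF L(1)] linear_scale[OF L(1)])
  let ?P = riesz_measure
  note P = finite_riesz_measure sets_riesz_measure
  have "measure ?P UNIV \<le> L (const_bcontfun 1)"
    using measure_riesz_measure_le[of UNIV 1 "const_bcontfun 1"] by simp
  also have "\<dots> \<le> G F H (\<lambda>x. x)" using L_le[OF scaled_id_majorant[of _ 1]] by simp
  finally have "trace_integral (moment_matrix ?P) \<le> G F H (\<lambda>x. x)"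
    using trace_integral_moment_matrix_le[OF P] by simp
  moreover have "G F H u = mat_integral (moment_matrix ?P) (deformation u)" if test: "u \<in> test_functions" for u
  proof -
    have u: "u \<in> C1_star" using test test_functions_subset_C1_star by auto
    obtain B where B: "\<And>x i j. \<bar>deformation u x $ i $ j\<bar> \<le> B" using C1_star_deformation_bounded[OF u] by blast
    \<comment> \<open>On unit vectors the cutoff is 1 and \<open>f\<close> is the quadratic form
      itself; elsewhere it makes \<open>f\<close> bounded with compact support, as the Riesz theorem
      demands.\<close>
    define f where "f z = quad_form (deformation u (fst z)) (snd z) * cutoff (snd z)" for z
    define h where "h = Bcontfun f"
    have h: "apply_bcontfun h = f"
      unfolding h_def
    proof (rule apply_Bcontfun_real)
      show "continuous_on UNIV f"
        unfolding f_def quad_form_def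
        by (intro continuous_intros continuous_on_compose2[OF continuous_on_deformation[OF u] continuous_on_fst]) auto
      have "\<bar>f z\<bar> \<le> (\<Sum>i\<in>(UNIV::'d set). \<Sum>j\<in>(UNIV::'d set). \<bar>B\<bar> * 1)" for z
        unfolding f_def sum_weight_quad_form[symmetric]
        by (intro order_trans[OF sum_abs] sum_mono; (intro order_trans[OF sum_abs] sum_mono)?;
            unfold abs_mult; intro mult_mono abs_weight_le order_trans[OF B abs_ge_self]; simp)
      then show "\<bar>f z\<bar> \<le> (\<Sum>i\<in>(UNIV::'d set). \<Sum>j\<in>(UNIV::'d set). \<bar>B\<bar> * 1)" for z .
    qed
    let ?K = "closure {x. u x \<noteq> 0} \<times> cball (0 :: real^'d) 2"
    have "compact ?K" using test by (intro compact_Times) (auto simp: test_functions_def)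
    moreover have "h z = 0" if "z \<notin> ?K" for z
    proof (cases "fst z \<in> closure {x. u x \<noteq> 0}")
      case True
      then have "2 \<le> norm (snd z)" using that by (cases z) auto
      then show ?thesis by (simp add: h f_def cutoff_outside)
    next
      case False
      then show ?thesis
        by (simp add: h f_def quad_form_def deformation_nth test_functions_outside_support)
    qed
    ultimately have "(\<integral>z. f z \<partial>?P) = L h" unfolding h[symmetric] by (rule integral_riesz_measure)
    moreover have "L h = G F H u"
    \<comment> \<open>On the sphere \<open>h\<close> equals the quadratic form of the tensor of
      \<open>u\<close>, so \<open>u\<close> majorizes \<open>h\<close> and its negative majorizes
      \<open>- h\<close>. The two bounds pin down \<open>L h\<close>.\<close>
    proof (rule antisym)
      have unit: "h (x, \<xi>) = quad_form (deformation u x) \<xi>" if "norm \<xi> = 1" for x \<xi>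
        using that by (simp add: h f_def cutoff_unit)
      then show "L h \<le> G F H u" using u by (intro L_le majorant_valuesI) (simp_all add: majorizes_def)
      have "L (- h) \<le> G F H (\<lambda>x. (- 1) *\<^sub>R u x)"
      proof (intro L_le majorant_valuesI)
        show "majorizes (\<lambda>x. (- 1) *\<^sub>R u x) (- h)"
          unfolding majorizes_def C1_star_scaleR(2)[OF u] quad_form_scaleR using unit by simp
      qed (rule C1_star_scaleR(1)[OF u])
      then show "G F H u \<le> L h" unfolding G_scaleR[OF F H u] using linear_neg[OF L(1)] by simp
    qed
    moreover have "mat_integral (moment_matrix ?P) (deformation u) = (\<integral>z. f z \<partial>?P)"
      unfolding f_def
      by (intro mat_integral_moment_matrix[OF P _ B] borel_measurable_continuous_onI continuous_on_deformation u)
    ultimately show ?thesis by simp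
  qed
  ultimately show ?thesis using moment_matrix_psd[OF P] by blast
qed

end

theorem theorem2p1:
  fixes F :: "(real^'d) set \<Rightarrow> real^'d"
    and H :: "(real^'d) set \<Rightarrow> real^'d^'d"
  assumes "F \<in> vector_measures" and "finite_first_moment F"
    and "H \<in> psd_measures"
    and "\<forall>u \<in> MON. G F H u \<ge> 0"
  shows "\<exists>M \<in> psd_measures.
    (\<forall>u \<in> test_functions. G F H u = mat_integral M (deformation u)) \<and>
    trace_integral M \<le> - vec_integral F (\<lambda>x. x) - trace_integral H"
proof -
  have H: "H \<in> vector_measures" using assms(3) by (simp add: psd_measures_def sym_measures_def)
  show ?thesis
    using psd_representation[OF assms(1,2) H] assms(4) unfolding G_id[OF assms(1,2) H] by blast
qed

end
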